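(* Let $X_1,X_2,\ldots$ be independent random variables uniformly distributed on $[0,1]$, and for each $n$ let $\tau_n$ be the optimal stopping rule in the full-information best choice problem with $n$ observations, i.e. the rule maximising $\mathbb{P}(X_\tau=\max(X_1,\ldots,X_n))$ over all stopping rules $\tau\le n$ adapted to the sequence $(X_i)$. Let $c>0$ be the unique solution of $\int_0^c x^{-1}(e^x-1)\,\mathrm{d}x=1$ and let $$w(t)=-e^{-c}+\frac{e^{-ct}-e^{-ct/(1-t)}}{t}+\frac{e^{-ct}-te^{-c}}{1-t}+\frac{c}{1-t}\left\{I\left(\frac{c}{1-t},\,c\right)-I\left(\frac{ct}{1-t},\,ct\right)\right\},\qquad t\in\,]0,1[,$$ where, for $0<s<u$, $I(u,s)=\int_s^u\xi^{-1}e^{-\xi}\,\mathrm{d}\xi$, with the boundary values $w(0)=1-e^{-c}$ and $w(1)=e^{-c}$. Then, as $n\to\infty$, $$\max_{1\le i\le n}\left|w(i/n)-n\,\mathbb{P}\big(\tau_n=i,\ X_i=\max(X_1,\ldots,X_n)\big)\right|=O(n^{-1}).$$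
   Context: The optimal stopping rule $\tau_n$ has the explicit form (due to Gilbert and Mosteller) $$\tau_n=\min\{i\le n:\ X_i=\max(X_1,\ldots,X_i)\ \text{and}\ X_i\ge d_{n-i}\}$$ (with $\tau_n=n$ if there is no such $i$), where $d_0=0$ and, for $k\ge1$, the decision number $d_k\in\,]0,1[$ is the unique solution of $$\sum_{j=1}^k\frac{d_k^{-j}-1}{j}=1.$$ The boundary values of $w$ are its limits as $t\to0$ and $t\to1$, so that $w$ is continuous on $[0,1]$. Numerically, $c=0.804\ldots$. *)

theory Defs
  imports "HOL-Probability.Probability" "HOL-Library.Landau_Symbols"
begin

definition natural_filtration :: "'a measure \<Rightarrow> (nat \<Rightarrow> 'a \<Rightarrow> real) \<Rightarrow> nat \<Rightarrow> 'a measure" where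
  "natural_filtration M X k =
     vimage_algebra (space M) (\<lambda>\<omega>. \<lambda>j\<in>{1..k}. X j \<omega>) (\<Pi>\<^sub>M j\<in>{1..k}. borel)"

definition stopping_rule ::
    "'a measure \<Rightarrow> (nat \<Rightarrow> 'a \<Rightarrow> real) \<Rightarrow> nat \<Rightarrow> ('a \<Rightarrow> nat) \<Rightarrow> bool" where
  "stopping_rule M X n \<tau> \<longleftrightarrow>
     stopping_time (natural_filtration M X) \<tau> \<and> (\<forall>\<omega>\<in>space M. \<tau> \<omega> \<in> {1..n})"

definition success_prob ::
    "'a measure \<Rightarrow> (nat \<Rightarrow> 'a \<Rightarrow> real) \<Rightarrow> nat \<Rightarrow> ('a \<Rightarrow> nat) \<Rightarrow> real" where
  "success_prob M X n \<tau> =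
     measure M {\<omega> \<in> space M. X (\<tau> \<omega>) \<omega> = Max ((\<lambda>j. X j \<omega>) ` {1..n})}"

text \<open>
  For independent, uniformly distributed observations an optimal rule exists and is unique
  only up to null sets. Optimality is therefore a predicate; the probability of stopping at
  the overall maximum at a given time is the same for all optimal rules.
\<close>

definition optimal_stopping_rule ::
    "'a measure \<Rightarrow> (nat \<Rightarrow> 'a \<Rightarrow> real) \<Rightarrow> nat \<Rightarrow> ('a \<Rightarrow> nat) \<Rightarrow> bool" where
  "optimal_stopping_rule M X n \<tau> \<longleftrightarrow>
     stopping_rule M X n \<tau> \<and>
     (\<forall>\<sigma>. stopping_rule M X n \<sigma> \<longrightarrow> success_prob M X n \<sigma> \<le> success_prob M X n \<tau>)"

text \<open>The upper limit of integration is the first argument.\<close>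

definition exp_int :: "real \<Rightarrow> real \<Rightarrow> real" where
  "exp_int u s = integral {s..u} (\<lambda>\<xi>. exp (- \<xi>) / \<xi>)"

definition limit_weight :: "real \<Rightarrow> real \<Rightarrow> real" where
  "limit_weight c t =
     (if t = 0 then 1 - exp (- c)
      else if t = 1 then exp (- c)
      else - exp (- c)
        + (exp (- c * t) - exp (- c * t / (1 - t))) / t
        + (exp (- c * t) - t * exp (- c)) / (1 - t)
        + c / (1 - t) * (exp_int (c / (1 - t)) c - exp_int (c * t / (1 - t)) (c * t)))"

end

theory Submission
  imports Defs
begin

text \<open>
  A one-step-loss identity shows that the success probability of every stopping rule falls short of
  the dynamic programming value by the sum of its expected losses. The threshold rule of Gilbert and
  Mosteller has no loss, and almost surely any deviation from it has a strictly positive one, so every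
  optimal rule stops like the threshold rule. Writing \<open>d(k)\<close> for the decision numbers, a recursion for
  the joint law of not having stopped up to time \<open>l\<close> and the running maximum gives, for \<open>i \<ge> 2\<close>, the exact
  value of \<open>n P(\<tau> = i, X\<^sub>i = max)\<close> as the average over \<open>j < i\<close> of
  \<open>d(n - j)^n - d(n - i)^n + n / (n - i + 1) (d(n - j)^(i - 1) - d(n - j)^n)\<close>.

  The equation for \<open>d(k)\<close> is a Riemann sum for the equation defining \<open>c\<close>, whence
  \<open>d(k) = exp (- \<lambda>\<^sub>k / k)\<close> with \<open>ln 2 \<le> \<lambda>\<^sub>k \<le> c \<le> \<lambda>\<^sub>k + O(1/k)\<close>. Replacing \<open>\<lambda>\<^sub>k\<close> by \<open>c\<close> turns the average into
  a Riemann sum for \<open>w(t) = (1/t) \<integral>\<^sub>0\<^sup>t \<phi>\<^sub>t(s) ds\<close>, with a density \<open>\<phi>\<^sub>t\<close> that is Lipschitz uniformly in \<open>t\<close>;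
  the errors are \<open>O(1/n)\<close> since a factor \<open>exp (- n ln 2 / k)\<close> compensates all powers of \<open>n/k\<close>.
\<close>

subsection \<open>Decision numbers\<close>

text \<open>The index j of the average is the place of the maximum of the first i - 1 observations,
  uniform on its i - 1 possible values. Because the decision numbers fall in time, no earlier stop
  has occurred exactly when that maximum lies below the threshold of its own time: earlier records
  are smaller and face higher thresholds. This is why a single number d(n - j) governs each summand.

  The rule \<open>\<tau> n\<close> of the theorem is an arbitrary optimal rule, so it can be
  identified only almost surely; strictness of the losses needs observations that avoid the
  countably many decision numbers and a running maximum below 1.

  The analytic obstacle is uniformity up to i = n, where n / (n - i + 1) and 1 / (1 - t) are
  unbounded and the formula for the density degenerates at s = t = 1. The difference of powers is
  therefore written as an integral over [0,1], which absorbs the denominator before anything is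
  estimated, and densities are compared only at points s < 1.\<close>

definition decision_sum :: "nat \<Rightarrow> real \<Rightarrow> real" where
  "decision_sum k x = (\<Sum>j=1..k. (inverse x ^ j - 1) / real j)"

text \<open>For k = 0 the sum is empty and the equation has no solution; the value 0 makes a record
  at the last time acceptable.\<close>

definition decision_number :: "nat \<Rightarrow> real" where
  "decision_number k = (if k = 0 then 0 else SOME d. 0 < d \<and> d < 1 \<and> decision_sum k d = 1)"

text \<open>Winning probability of accepting the next observation above x, when k observations
  remain and the current maximum is x. If that observation comes with j left, itself included, the k
  - j before it stay below x, and integrating u^(j - 1) from x to 1 gives (1 - x^j) / j.\<close>

definition first_record_value :: "nat \<Rightarrow> real \<Rightarrow> real" where
  "first_record_value k x = (\<Sum>j=1..k. x ^ (k - j) * (1 - x ^ j) / real j)"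

lemma decision_sum_strict_antimono:
  assumes "0 < x" "x < y" "1 \<le> k"
  shows "decision_sum k y < decision_sum k x"
  unfolding decision_sum_def
proof (rule sum_strict_mono)
  fix j assume j: "j \<in> {1..k}"
  have "inverse y ^ j < inverse x ^ j"
    using assms j by (intro power_strict_mono less_imp_inverse_less) auto
  then show "(inverse y ^ j - 1) / real j < (inverse x ^ j - 1) / real j"
    using j by (intro divide_strict_right_mono) auto
qed (use assms in auto)

lemma decision_sum_Suc:
  "decision_sum (Suc k) x = decision_sum k x + (inverse x ^ Suc k - 1) / real (Suc k)"
  by (simp add: decision_sum_def)

lemma decision_sum_mono_index:
  assumes "0 < x" "x \<le> 1"
  shows "decision_sum k x \<le> decision_sum (Suc k) x"
  using one_le_power[of "inverse x" "Suc k"] assms unfolding decision_sum_Suc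
  by (simp add: one_le_inverse del: power_Suc)

lemma decision_sum_ge_first:
  assumes "1 \<le> k" "0 < x" "x \<le> 1"
  shows "inverse x - 1 \<le> decision_sum k x"
  using assms(1)
proof (induction k rule: dec_induct)
  case base
  then show ?case by (simp add: decision_sum_def)
next
  case (step m)
  then show ?case using decision_sum_mono_index[OF assms(2,3), of m] by linarith
qed

text \<open>The sum vanishes at 1, while at 1/2 its first summand alone is already 1.\<close>

lemma decision_number_exists:
  assumes "1 \<le> k"
  shows "\<exists>d. 0 < d \<and> d < 1 \<and> decision_sum k d = 1"
proof -
  have cont: "continuous_on {1/2..1} (decision_sum k)"
    unfolding decision_sum_def by (intro continuous_intros) auto
  have "decision_sum k 1 = 0" by (simp add: decision_sum_def)
  moreover have "1 \<le> decision_sum k (1/2)"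
    using decision_sum_ge_first[OF assms, of "1/2"] by simp
  ultimately obtain d where d: "1/2 \<le> d" "d \<le> 1" "decision_sum k d = 1"
    using IVT2'[of "decision_sum k" 1 1 "1/2"] cont by auto
  have "d \<noteq> 1" using d \<open>decision_sum k 1 = 0\<close> by auto
  then show ?thesis using d by (intro exI[of _ d]) auto
qed

lemma decision_number:
  assumes "1 \<le> k"
  shows "0 < decision_number k" "decision_number k < 1" "decision_sum k (decision_number k) = 1"
  using someI_ex[OF decision_number_exists[OF assms]] assms by (auto simp: decision_number_def)

lemma decision_number_0 [simp]: "decision_number 0 = 0"
  by (simp add: decision_number_def)

lemma decision_number_nonneg: "0 \<le> decision_number k"
  using decision_number(1)[of k] by (cases "k = 0") auto

lemma decision_number_less_1: "decision_number k < 1"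
  using decision_number(2)[of k] by (cases "k = 0") auto

text \<open>A further summand is nonnegative on ]0,1], so the decreasing sum comes down to 1 later.
  Hence the thresholds fall in time, on which both the optimality argument and the law of the
  running maximum rest.\<close>

lemma decision_number_mono_Suc: "decision_number k \<le> decision_number (Suc k)"
proof (cases "k = 0")
  case False
  then have k: "1 \<le> k" by simp
  show ?thesis
  proof (rule ccontr)
    assume *: "\<not> ?thesis"
    let ?d = "decision_number k" and ?e = "decision_number (Suc k)"
    have "decision_sum (Suc k) ?d < decision_sum (Suc k) ?e"
      using * decision_number(1)[of "Suc k"] by (intro decision_sum_strict_antimono) auto
    moreover have "decision_sum k ?d \<le> decision_sum (Suc k) ?d"
      using decision_number[OF k] by (intro decision_sum_mono_index) auto
    ultimately show False
      using decision_number(3)[OF k] decision_number(3)[of "Suc k"] by simp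
  qed
qed (simp add: decision_number_nonneg)

lemma decision_number_mono: "k \<le> l \<Longrightarrow> decision_number k \<le> decision_number l"
  using decision_number_mono_Suc by (rule lift_Suc_mono_le)

lemma first_record_value_0 [simp]: "first_record_value 0 x = 0"
  by (simp add: first_record_value_def)

lemma first_record_value_Suc:
  "first_record_value (Suc k) x = x * first_record_value k x + (1 - x ^ Suc k) / real (Suc k)"
proof -
  have "x * (x ^ (k - j) * (1 - x ^ j) / real j) = x ^ (Suc k - j) * (1 - x ^ j) / real j"
    if "j \<in> {1..k}" for j
    using that by (simp add: Suc_diff_le)
  then have "x * first_record_value k x = (\<Sum>j=1..k. x ^ (Suc k - j) * (1 - x ^ j) / real j)"
    unfolding first_record_value_def sum_distrib_left by (rule sum.cong[OF refl])
  then show ?thesis by (simp add: first_record_value_def)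
qed

text \<open>Accepting x with k observations left wins with probability x^k, so
  \<open>decision_sum k x\<close> is the ratio of waiting for the next record to accepting. The
  decision number is the point of indifference.\<close>

lemma first_record_value_eq:
  assumes "0 < x"
  shows "first_record_value k x = x ^ k * decision_sum k x"
  unfolding first_record_value_def decision_sum_def sum_distrib_left
proof (rule sum.cong)
  fix j assume "j \<in> {1..k}"
  then have "x ^ k = x ^ (k - j) * x ^ j" by (simp flip: power_add)
  moreover have "x ^ j * inverse x ^ j = 1"
    using assms by (simp flip: power_mult_distrib)
  ultimately show "x ^ (k - j) * (1 - x ^ j) / real j = x ^ k * ((inverse x ^ j - 1) / real j)"
    by (simp add: right_diff_distrib mult.assoc)
qed simp

lemma first_record_value_nonneg:
  assumes "0 \<le> x" "x \<le> 1"
  shows "0 \<le> first_record_value k x"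
  unfolding first_record_value_def
  using assms by (intro sum_nonneg divide_nonneg_nonneg mult_nonneg_nonneg) (auto simp: power_le_one)

lemma first_record_value_pos:
  assumes "0 \<le> x" "x < 1"
  shows "0 < first_record_value (Suc k) x"
proof -
  have "x ^ Suc k < 1"
    using assms by (cases "x = 0") (auto intro!: power_Suc_less_one simp del: power_Suc)
  then show ?thesis
    using assms first_record_value_nonneg[of x k] unfolding first_record_value_Suc
    by (intro add_nonneg_pos divide_pos_pos mult_nonneg_nonneg) auto
qed

lemma first_record_value_gt:
  assumes "0 \<le> x" "x < decision_number k"
  shows "x ^ k < first_record_value k x"
proof (cases "x = 0")
  case True
  with assms have "k \<noteq> 0" by (cases "k = 0") auto
  then obtain l where "k = Suc l" using not0_implies_Suc by blast
  then show ?thesis using True first_record_value_pos[of 0 l] by simp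
next
  case False
  with assms have x: "0 < x" by simp
  have k: "1 \<le> k" using assms by (cases "k = 0") auto
  have "1 < decision_sum k x"
    using decision_sum_strict_antimono[OF x assms(2) k] decision_number(3)[OF k] by simp
  then show ?thesis using x by (simp add: first_record_value_eq)
qed

lemma first_record_value_less:
  assumes "decision_number k < x"
  shows "first_record_value k x < x ^ k"
proof (cases "k = 0")
  case False
  then have k: "1 \<le> k" by simp
  have x: "0 < x" using assms decision_number(1)[OF k] by linarith
  have "decision_sum k x < 1"
    using decision_sum_strict_antimono[OF _ assms k] decision_number[OF k] by simp
  then show ?thesis using x by (simp add: first_record_value_eq)
qed simp

lemma first_record_value_le:
  assumes "decision_number k \<le> x"
  shows "first_record_value k x \<le> x ^ k"
proof (cases "k = 0")
  case False
  then have "1 \<le> k" by simp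
  from decision_number[OF this] assms show ?thesis
    using first_record_value_less[of k x]
    by (cases "x = decision_number k") (auto simp: first_record_value_eq)
qed simp

subsection \<open>Asymptotics of the decision numbers\<close>

text \<open>The value at 0 is the limit; division by zero would give 0 and break the lower bound
  1.\<close>

definition expm1_quot :: "real \<Rightarrow> real" where
  "expm1_quot x = (if x = 0 then 1 else (exp x - 1) / x)"

lemma expm1_quot_ge_1: "0 \<le> x \<Longrightarrow> 1 \<le> expm1_quot x"
  using exp_ge_add_one_self[of x] by (auto simp: expm1_quot_def field_simps)

text \<open>The quotient is the slope of the chord of the convex function exp over [0, x]; here x is
  the convex combination of 0 and y with weight x / y on y.\<close>

lemma expm1_quot_mono:
  assumes "0 \<le> x" "x \<le> y"
  shows "expm1_quot x \<le> expm1_quot y"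
proof (cases "x = 0")
  case True
  then show ?thesis using expm1_quot_ge_1[of y] assms by (simp add: expm1_quot_def)
next
  case False
  with assms have xy: "0 < x" "0 < y" by auto
  have "exp ((1 - x / y) * 0 + (x / y) * y) \<le> (1 - x / y) * exp 0 + (x / y) * exp y"
    using convex_onD[OF exp_convex, of "x / y" 0 y] xy assms by (simp add: field_simps)
  then have "exp x - 1 \<le> (x / y) * (exp y - 1)" using xy by (simp add: algebra_simps)
  then have "(exp x - 1) / x \<le> ((x / y) * (exp y - 1)) / x" using xy by (intro divide_right_mono) auto
  then show ?thesis using xy by (simp add: expm1_quot_def)
qed

text \<open>On each cell the right endpoint value exceeds the integral by at most h times the
  increase of g, and these increases telescope.\<close>

lemma mono_riemann_sum:
  fixes g :: "real \<Rightarrow> real"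
  assumes mono: "\<And>x y. 0 \<le> x \<Longrightarrow> x \<le> y \<Longrightarrow> g x \<le> g y"
    and int: "g integrable_on {0..h * real m}" and h: "0 \<le> h" and "j \<le> m"
  shows "integral {0..h * real j} g \<le> (\<Sum>i=1..j. h * g (h * real i)) \<and>
         (\<Sum>i=1..j. h * g (h * real i)) \<le> integral {0..h * real j} g + h * (g (h * real j) - g 0)"
  using \<open>j \<le> m\<close>
proof (induction j)
  case (Suc j)
  have le: "h * real (Suc j) \<le> h * real m" using Suc.prems h by (intro mult_left_mono) auto
  have le': "h * real j \<le> h * real (Suc j)" using h by (intro mult_left_mono) auto
  have pos: "0 \<le> h * real j" using h by simp
  have int': "g integrable_on {0..h * real (Suc j)}"
    using integrable_on_subinterval[OF int] le by simp
  have int'': "g integrable_on {h * real j..h * real (Suc j)}"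
    using integrable_on_subinterval[OF int] le pos by simp
  have comb: "integral {0..h * real (Suc j)} g
     = integral {0..h * real j} g + integral {h * real j..h * real (Suc j)} g"
    using Henstock_Kurzweil_Integration.integral_combine[OF pos le' int'] by simp
  have len: "h * real (Suc j) - h * real j = h" by (simp add: algebra_simps)
  have up: "integral {h * real j..h * real (Suc j)} g \<le> h * g (h * real (Suc j))"
    using integral_le[OF int'' integrable_const_ivl[of "g (h * real (Suc j))"]] mono pos len le'
    by (simp del: of_nat_Suc)
  have lo: "h * g (h * real j) \<le> integral {h * real j..h * real (Suc j)} g"
    using integral_le[OF integrable_const_ivl[of "g (h * real j)"] int''] mono pos len le'
    by (simp del: of_nat_Suc)
  show ?case using Suc.IH Suc.prems up lo comb by (simp add: algebra_simps)
qed simp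

text \<open>The \<open>\<lambda>\<^sub>k\<close> of the overview.\<close>

definition decision_rate :: "nat \<Rightarrow> real" where
  "decision_rate k = - real k * ln (decision_number k)"

lemma decision_number_eq_exp:
  assumes "1 \<le> k"
  shows "decision_number k = exp (- decision_rate k / real k)"
  using decision_number[OF assms] assms by (simp add: decision_rate_def)

text \<open>For l \<ge> 0 this is the right endpoint sum of \<open>expm1_quot\<close> over [0, l]
  with k cells: the choice x = exp (- l / k) makes j enter only through the node l j / k.\<close>

lemma decision_sum_exp:
  assumes "1 \<le> k"
  shows "decision_sum k (exp (- l / real k)) = (\<Sum>j=1..k. (l / real k) * expm1_quot (l / real k * real j))"
  unfolding decision_sum_def
proof (rule sum.cong)
  fix j assume j: "j \<in> {1..k}"
  have "inverse (exp (- l / real k)) ^ j = exp (l / real k * real j)"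
    by (simp add: mult.commute flip: exp_minus exp_of_nat_mult)
  then show "(inverse (exp (- l / real k)) ^ j - 1) / real j = l / real k * expm1_quot (l / real k * real j)"
    using j assms by (cases "l = 0") (auto simp: expm1_quot_def field_simps)
qed simp

lemma decision_rate_sum:
  assumes "1 \<le> k"
  shows "(\<Sum>j=1..k. (decision_rate k / real k) * expm1_quot (decision_rate k / real k * real j)) = 1"
  using decision_number(3)[OF assms]
  unfolding decision_number_eq_exp[OF assms] decision_sum_exp[OF assms] .

locale decision_limit =
  fixes c :: real
  assumes c_pos: "c > 0" and c_eq: "integral {0..c} (\<lambda>x. (exp x - 1) / x) = 1"
begin

lemma expm1_quot_integrable: "expm1_quot integrable_on {0..c}"
  and expm1_quot_integral: "integral {0..c} expm1_quot = 1"
proof -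
  \<comment> \<open>A function that is not integrable has integral 0 by default, so
    \<open>c_eq\<close> itself yields integrability.\<close>
  have "(\<lambda>x. (exp x - 1) / x) integrable_on {0..c}"
    using c_eq not_integrable_integral by fastforce
  then have "((\<lambda>x. (exp x - 1) / x) has_integral 1) {0..c}"
    using c_eq by (simp add: has_integral_integral)
  then have "(expm1_quot has_integral 1) {0..c}"
    by (rule has_integral_spike_finite[of "{0}", rotated 2]) (auto simp: expm1_quot_def)
  then show "expm1_quot integrable_on {0..c}" "integral {0..c} expm1_quot = 1"
    by (auto simp: has_integral_iff)
qed

text \<open>Right endpoint sums of an increasing function overestimate, so at l = c the sum is at
  least 1, and it increases with l.\<close>

lemma decision_rate_le:
  assumes k: "1 \<le> k"
  shows "decision_rate k \<le> c"
proof (rule ccontr)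
  assume *: "\<not> ?thesis"
  have "c / real k * real k = c" using k by simp
  then have "1 \<le> decision_sum k (exp (- c / real k))"
    unfolding decision_sum_exp[OF k]
    using mono_riemann_sum[of expm1_quot "c / real k" k k] expm1_quot_mono
      expm1_quot_integrable expm1_quot_integral c_pos by simp
  also have "\<dots> < decision_sum k (exp (- decision_rate k / real k))"
    using * k by (intro decision_sum_strict_antimono) (auto simp: divide_strict_right_mono)
  also have "\<dots> = 1"
    using decision_number(3)[OF k] k by (simp add: decision_number_eq_exp)
  finally show False by simp
qed

text \<open>Bounding every node value by the one at the right end gives 1 \<le> exp l - 1 for the
  rate l. This bound, uniform in k, supplies the decay used in all later estimates.\<close>

lemma decision_rate_ge_ln2:
  assumes k: "1 \<le> k"
  shows "ln 2 \<le> decision_rate k"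
proof -
  let ?l = "decision_rate k"
  have l: "0 \<le> ?l"
    using decision_number[OF k] by (simp add: decision_rate_def mult_nonneg_nonpos)
  have "1 = (\<Sum>j=1..k. (?l / real k) * expm1_quot (?l / real k * real j))"
    using decision_rate_sum[OF k] by simp
  also have "\<dots> \<le> (\<Sum>j=1..k. (?l / real k) * expm1_quot ?l)"
  proof (intro sum_mono mult_left_mono expm1_quot_mono)
    fix j assume "j \<in> {1..k}"
    then have "?l * (real j / real k) \<le> ?l" using l by (intro mult_left_le) auto
    then show "?l / real k * real j \<le> ?l" by simp
  qed (use l in auto)
  also have "\<dots> = ?l * expm1_quot ?l" using k by simp
  also have "\<dots> = exp ?l - 1" by (simp add: expm1_quot_def)
  finally have "2 \<le> exp ?l" by simp
  then show ?thesis using ln_mono[of 2 "exp ?l"] by simp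
qed

text \<open>The excess of the right endpoint sum over the integral up to the rate is at most exp c /
  k. It dominates the missing piece of the integral up to c, where the integrand is at least
  1.\<close>

lemma decision_rate_ge:
  assumes k: "1 \<le> k"
  shows "c - decision_rate k \<le> exp c / real k"
proof -
  let ?l = "decision_rate k"
  have l: "0 < ?l" using decision_rate_ge_ln2[OF k] ln_2_less_1 by (smt (verit) ln_gt_zero)
  note lc = decision_rate_le[OF k]
  have int: "expm1_quot integrable_on {0..?l}" "expm1_quot integrable_on {?l..c}"
    using integrable_on_subinterval[OF expm1_quot_integrable] l lc by auto
  have "1 = (\<Sum>j=1..k. (?l / real k) * expm1_quot (?l / real k * real j))"
    using decision_rate_sum[OF k] by simp
  also have "\<dots> \<le> integral {0..?l} expm1_quot + ?l / real k * (expm1_quot ?l - expm1_quot 0)"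
    using mono_riemann_sum[of expm1_quot "?l / real k" k k] expm1_quot_mono int l k by simp
  also have "?l / real k * (expm1_quot ?l - expm1_quot 0) \<le> exp ?l / real k"
    using l k by (simp add: expm1_quot_def field_simps)
  also have "exp ?l / real k \<le> exp c / real k" using lc k by (simp add: divide_right_mono)
  also have "integral {0..?l} expm1_quot = 1 - integral {?l..c} expm1_quot"
    using Henstock_Kurzweil_Integration.integral_combine[OF _ lc expm1_quot_integrable] l expm1_quot_integral by simp
  finally have "integral {?l..c} expm1_quot \<le> exp c / real k" by simp
  moreover have "c - ?l \<le> integral {?l..c} expm1_quot"
    using integral_le[OF integrable_const_ivl[of 1] int(2)] expm1_quot_ge_1 l lc by simp
  ultimately show ?thesis by linarith
qed

end

subsection \<open>The limiting weight\<close>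

lemma exp_minus_diff_le:
  fixes u v w :: real
  assumes "w \<le> u" "w \<le> v"
  shows "\<bar>exp (- u) - exp (- v)\<bar> \<le> exp (- w) * \<bar>u - v\<bar>"
proof -
  have *: "exp (- a) - exp (- b) \<le> exp (- w) * (b - a)" if "w \<le> a" "a \<le> b" for a b :: real
  proof -
    have "exp (- a) - exp (- b) = exp (- a) * (1 - exp (- (b - a)))"
      by (simp add: algebra_simps flip: exp_add)
    also have "\<dots> \<le> exp (- a) * (b - a)"
      using exp_ge_add_one_self[of "- (b - a)"] by (intro mult_left_mono) (linarith, simp)
    also have "\<dots> \<le> exp (- w) * (b - a)"
      using that by (intro mult_right_mono) auto
    finally show ?thesis .
  qed
  show ?thesis
    using *[of u v] *[of v u] assms by (cases "u \<le> v") (auto simp: abs_if)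
qed

text \<open>Parametrising the segment from a to b by [0,1] turns a difference of exponentials
  divided by b - a into an integral over a fixed interval, which stays meaningful for b = a and can
  be compared integrand by integrand.\<close>

lemma has_integral_exp_segment:
  fixes m a b :: real
  shows "((\<lambda>v. (b - a) * (m * exp (- m * (a + v * (b - a))))) has_integral (exp (- m * a) - exp (- m * b))) {0..1}"
proof -
  have "((\<lambda>v. (b - a) * (m * exp (- m * (a + v * (b - a))))) has_integral
          (- exp (- m * (a + 1 * (b - a))) - (- exp (- m * (a + 0 * (b - a)))))) {0..1}"
    by (intro fundamental_theorem_of_calculus)
       (auto intro!: derivative_eq_intros simp flip: has_real_derivative_iff_has_vector_derivative)
  then show ?thesis by simp
qed

lemma integral_diff_le_const:
  fixes f g :: "real \<Rightarrow> real"
  assumes "continuous_on {0..1} f" "continuous_on {0..1} g"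
    and "\<And>v. 0 \<le> v \<Longrightarrow> v \<le> 1 \<Longrightarrow> \<bar>f v - g v\<bar> \<le> B"
  shows "\<bar>integral {0..1} f - integral {0..1} g\<bar> \<le> B"
proof -
  have fg: "f integrable_on {0..1}" "g integrable_on {0..1}"
    using assms by (auto intro: integrable_continuous_interval)
  have "norm (integral {0..1} (\<lambda>v. f v - g v)) \<le> integral {0..1} (\<lambda>v::real. B)"
    by (rule Henstock_Kurzweil_Integration.integral_norm_bound_integral)
       (use fg assms(3) in \<open>auto intro: Henstock_Kurzweil_Integration.integrable_diff\<close>)
  then show ?thesis using fg by (simp add: Henstock_Kurzweil_Integration.integral_diff)
qed

text \<open>The average has i - 1 terms, so [0, t] is cut into i - 1 equal cells, slightly longer
  than 1 / n. On each cell the mean value theorem writes the increment of P as its length times f z,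
  and z is within 1 / n of the sample point. Only values of f to the left of t enter.\<close>

lemma average_approx:
  fixes f P :: "real \<Rightarrow> real"
  assumes n: "1 \<le> n" and i: "2 \<le> i" and t: "t = real i / real n"
    and cont: "continuous_on {0..t} P"
    and deriv: "\<And>s. 0 < s \<Longrightarrow> s < t \<Longrightarrow> (P has_real_derivative f s) (at s)"
    and lip: "\<And>s r. 0 \<le> s \<Longrightarrow> s < t \<Longrightarrow> 0 \<le> r \<Longrightarrow> r < t \<Longrightarrow> \<bar>f s - f r\<bar> \<le> L * \<bar>s - r\<bar>"
    and L: "0 \<le> L"
  shows "\<bar>(P t - P 0) / t - (\<Sum>j=1..<i. f (real j / real n)) / real (i - 1)\<bar> \<le> L / real n"
proof -
  define N where "N = i - 1"
  have N: "1 \<le> N" "real i = real N + 1" "i = Suc N" using i by (auto simp: N_def)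
  have t0: "0 < t" using t n i by simp
  define p where "p j = t * real j / real N" for j
  have piece: "\<bar>(P (p (Suc j)) - P (p j)) - t / real N * f (real (Suc j) / real n)\<bar> \<le> t / real N * (L / real n)"
    if j: "j < N" for j
  proof -
    have "t * real (Suc j) \<le> t * real N" using t0 j by (intro mult_left_mono) auto
    then have pj: "0 \<le> p j" "p j < p (Suc j)" "p (Suc j) \<le> t"
      using t0 j N by (auto simp: p_def field_simps)
    have step: "p (Suc j) - p j = t / real N" by (simp add: p_def distrib_left add_divide_distrib)
    have contj: "continuous_on {p j..p (Suc j)} P"
      using pj by (intro continuous_on_subset[OF cont]) auto
    have "(P has_real_derivative f s) (at s)" if "p j < s" "s < p (Suc j)" for s
      using that pj by (intro deriv) auto
    then have "\<exists>l z. p j < z \<and> z < p (Suc j) \<and> DERIV P z :> l \<and> P (p (Suc j)) - P (p j) = (p (Suc j) - p j) * l"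
      using pj contj by (intro MVT) (auto simp: real_differentiable_def)
    then obtain l z where z: "p j < z" "z < p (Suc j)" and l: "DERIV P z :> l"
      and eq: "P (p (Suc j)) - P (p j) = (p (Suc j) - p j) * l" by blast
    have "l = f z" using l z pj by (intro DERIV_unique[OF l] deriv) auto
    \<comment> \<open>With N = i - 1 the node \<open>p j\<close> lies between j / n and (j + 1) / n,
      so the whole cell lies within 1 / n of (j + 1) / n.\<close>
    have "real j / real n \<le> p j" using j N n by (simp add: p_def t field_simps)
    moreover have "p (Suc j) \<le> real (Suc j) / real n + 1 / real n"
    proof -
      have "real (Suc j) / real N \<le> 1" using j N by simp
      then have "real (Suc j) / real N / real n \<le> 1 / real n"
        using n by (intro divide_right_mono) auto
      moreover have "p (Suc j) = real (Suc j) / real n + real (Suc j) / real N / real n"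
      proof -
        have "(real N + 1) / real n * z / real N = z / real n + z / real N / real n" for z
          using N(1) n by (simp add: field_simps)
        then show ?thesis unfolding p_def t N(2) .
      qed
      ultimately show ?thesis by linarith
    qed
    moreover have "real (Suc j) / real n = real j / real n + 1 / real n" by (simp add: add_divide_distrib)
    ultimately have close: "\<bar>z - real (Suc j) / real n\<bar> \<le> 1 / real n" using z by linarith
    have "\<bar>f z - f (real (Suc j) / real n)\<bar> \<le> L * \<bar>z - real (Suc j) / real n\<bar>"
      proof (rule lip)
      show "0 \<le> z" "z < t" "0 \<le> real (Suc j) / real n" using z pj by auto
      show "real (Suc j) / real n < t" unfolding t using j n N by (intro divide_strict_right_mono) auto
    qed
    also have "\<dots> \<le> L / real n" using mult_left_mono[OF close L] by simp
    finally have "t / real N * \<bar>f z - f (real (Suc j) / real n)\<bar> \<le> t / real N * (L / real n)"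
      using t0 by (intro mult_left_mono) auto
    then show ?thesis using t0 N
      unfolding eq \<open>l = f z\<close> step right_diff_distrib[symmetric] abs_mult by simp
  qed
  have "p N = t" "p 0 = 0" using N(1) by (auto simp: p_def)
  then have "P t - P 0 = (\<Sum>j<N. P (p (Suc j)) - P (p j))"
    unfolding sum_lessThan_telescope[of "\<lambda>j. P (p j)"] by simp
  moreover have "(\<Sum>j=1..<i. f (real j / real n)) = (\<Sum>j<N. f (real (Suc j) / real n))"
    unfolding N(3) by (rule sum.reindex_bij_witness[of _ Suc "\<lambda>j. j - 1"]) auto
  ultimately have "\<bar>(P t - P 0) - t / real N * (\<Sum>j=1..<i. f (real j / real n))\<bar>
      = \<bar>\<Sum>j<N. (P (p (Suc j)) - P (p j)) - t / real N * f (real (Suc j) / real n)\<bar>"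
    by (simp add: sum_subtractf sum_distrib_left)
  also have "\<dots> \<le> (\<Sum>j<N. t / real N * (L / real n))"
    by (intro order_trans[OF sum_abs] sum_mono piece) auto
  also have "\<dots> = t * (L / real n)" using N by simp
  finally have le: "\<bar>(P t - P 0) - t / real N * (\<Sum>j=1..<i. f (real j / real n))\<bar> \<le> t * (L / real n)" .
  have "(P t - P 0) / t - (\<Sum>j=1..<i. f (real j / real n)) / real N
      = ((P t - P 0) - t / real N * (\<Sum>j=1..<i. f (real j / real n))) / t"
    using t0 by (simp add: diff_divide_distrib)
  also have "\<bar>\<dots>\<bar> = \<bar>(P t - P 0) - t / real N * (\<Sum>j=1..<i. f (real j / real n))\<bar> / t"
    using t0 by (simp only: abs_divide abs_of_pos)
  also have "\<dots> \<le> t * (L / real n) / t"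
    using le t0 by (intro divide_right_mono) auto
  also have "\<dots> = L / real n" using t0 by simp
  finally show ?thesis unfolding N_def .
qed

text \<open>For i = 1 there is no earlier observation to average over; the value is the integral of
  n u^(n - 1) from d(n - 1) to 1.\<close>

definition stop_weight :: "nat \<Rightarrow> nat \<Rightarrow> real" where
  "stop_weight n i = (if i = 1 then 1 - decision_number (n - 1) ^ n
     else (\<Sum>j=1..<i. decision_number (n - j) ^ n - decision_number (n - i) ^ n
        + real n / real (n - i + 1) * (decision_number (n - j) ^ (i - 1) - decision_number (n - j) ^ n)) / real (i - 1))"

section \<open>Replacing the decision numbers by their limiting form\<close>

context decision_limit
begin

text \<open>Comes from (y / 3)^3 \<le> exp y with y = x ln 2. Third powers of x = n / k or x = 1 /
  (1 - s) are the highest that occur.\<close>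

definition decay_const :: real where
  "decay_const = 27 / ln 2 ^ 3"

lemma ln2_pos: "0 < ln (2::real)" by simp

lemma decay_const_nonneg: "0 \<le> decay_const" by (simp add: decay_const_def)

lemma ln2_le_c: "ln 2 \<le> c"
  using decision_rate_ge_ln2[of 1] decision_rate_le[of 1] by simp

lemma cube_exp_le:
  assumes "0 \<le> x"
  shows "x ^ 3 * exp (- (ln 2 * x)) \<le> decay_const"
proof -
  have "(ln 2 * x / 3) ^ 3 \<le> exp (ln 2 * x / 3) ^ 3"
    using assms exp_ge_add_one_self[of "ln 2 * x / 3"] by (intro power_mono) (linarith, simp)
  then have "(ln 2 * x) ^ 3 / 27 \<le> exp (ln 2 * x)"
    by (simp add: power_divide flip: exp_of_nat_mult)
  then have "(ln 2 * x) ^ 3 * exp (- (ln 2 * x)) \<le> 27"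
    by (simp add: exp_minus field_simps)
  then show ?thesis by (simp add: decay_const_def power_mult_distrib field_simps)
qed

lemma power_exp_le:
  assumes "1 \<le> x" "m \<le> 3"
  shows "x ^ m * exp (- (ln 2 * x)) \<le> decay_const"
proof -
  have "x ^ m * exp (- (ln 2 * x)) \<le> x ^ 3 * exp (- (ln 2 * x))"
    using assms by (intro mult_right_mono power_increasing) auto
  also have "\<dots> \<le> decay_const" using assms by (intro cube_exp_le) simp
  finally show ?thesis .
qed

text \<open>At \<open>t = 1\<close> division by zero would give \<open>1\<close> instead of the limit \<open>0\<close>.\<close>

definition final_term :: "real \<Rightarrow> real" where
  "final_term t = (if t = 1 then 0 else exp (- c / (1 - t)))"

text \<open>
  The integral form of \<open>(exp (- c x t) - exp (- c x)) / (1 - t)\<close> also covers \<open>t = 1\<close>.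
\<close>

definition exp_mean :: "real \<Rightarrow> real \<Rightarrow> real" where
  "exp_mean t x = integral {0..1} (\<lambda>v. c * x * exp (- (c * x * (t + v * (1 - t)))))"

text \<open>The \<open>\<phi>\<^sub>t\<close> of the overview: with s = j / n and t = i / n the
  three terms are the limiting forms of d(n - j)^n, of d(n - i)^n and of n / (n - i + 1) times the
  difference of powers.\<close>

definition weight_density :: "real \<Rightarrow> real \<Rightarrow> real" where
  "weight_density t s = exp (- c / (1 - s)) - final_term t + exp_mean t (1 / (1 - s))"

lemma exp_mean_eq:
  assumes "t < 1"
  shows "exp_mean t x = (exp (- c * x * t) - exp (- c * x)) / (1 - t)"
proof -
  have "((\<lambda>v. inverse (1 - t) * ((1 - t) * ((c * x) * exp (- (c * x) * (t + v * (1 - t)))))) has_integral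
      inverse (1 - t) * (exp (- (c * x) * t) - exp (- (c * x) * 1))) {0..1}"
    by (intro has_integral_mult_right has_integral_exp_segment)
  moreover have "inverse (1 - t) * ((1 - t) * z) = z" for z using assms by simp
  ultimately show ?thesis
    unfolding exp_mean_def by (intro integral_unique) (simp add: divide_inverse mult.commute)
qed

lemma exp_mean_1: "exp_mean 1 x = c * x * exp (- c * x)"
  by (simp add: exp_mean_def)

text \<open>With x = n / k and l the rate, both sides are exponentials, of - l x and of - c x. The
  rate error exp c / k is (x / n) exp c, so the exponents differ by at most (x^2 / n) exp c, and the
  factor exp (- x ln 2) absorbs x^2.\<close>

lemma decision_number_power_approx:
  assumes "1 \<le> k" "k \<le> n"
  shows "\<bar>decision_number k ^ n - exp (- c * real n / real k)\<bar> \<le> decay_const * exp c / real n"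
proof -
  define x l where "x = real n / real k" and "l = decision_rate k"
  have x: "1 \<le> x" using assms by (simp add: x_def)
  have l: "ln 2 \<le> l" "l \<le> c" "c - l \<le> exp c / real k"
    using decision_rate_ge_ln2 decision_rate_le decision_rate_ge assms by (auto simp: l_def)
  have "decision_number k ^ n = exp (- (l * x))"
    using assms by (simp add: decision_number_eq_exp x_def l_def mult.commute flip: exp_of_nat_mult)
  moreover have "exp (- c * real n / real k) = exp (- (c * x))" by (simp add: x_def)
  ultimately have "\<bar>decision_number k ^ n - exp (- c * real n / real k)\<bar> = \<bar>exp (- (l * x)) - exp (- (c * x))\<bar>"
    by (simp only:)
  also have "\<dots> \<le> exp (- (ln 2 * x)) * \<bar>l * x - c * x\<bar>"
    using l ln2_le_c x by (intro exp_minus_diff_le mult_right_mono) auto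
  also have "\<dots> \<le> exp (- (ln 2 * x)) * (exp c * x ^ 2 / real n)"
  proof (intro mult_left_mono)
    have "\<bar>l * x - c * x\<bar> = (c - l) * x"
      using l x by (simp add: abs_if algebra_simps mult_le_cancel_left)
    also have "\<dots> \<le> exp c / real k * x"
      using l x by (intro mult_right_mono) auto
    also have "\<dots> = exp c * x ^ 2 / real n"
      using assms by (simp add: x_def power2_eq_square)
    finally show "\<bar>l * x - c * x\<bar> \<le> exp c * x ^ 2 / real n" .
  qed simp
  also have "\<dots> = (x ^ 2 * exp (- (ln 2 * x))) * exp c / real n" by simp
  also have "\<dots> \<le> decay_const * exp c / real n"
    using power_exp_le[OF x, of 2] by (intro divide_right_mono mult_right_mono) auto
  finally show ?thesis .
qed

text \<open>The factor 2 is exp (ln 2): only x - 1, not x, is available as a lower bound in the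
  exponents below. The three summands come from the prefactor, from the rate in the exponent and
  from the shift between y and z.\<close>

definition pointwise_const :: real where
  "pointwise_const = 2 * decay_const * (exp c + c * exp c + c ^ 2)"

text \<open>Compares two segment integrands at the same parameter: y belongs to the segment from i -
  1 to n and z to that from i to n, hence the distance at most 1. Both are at least j = n - k, which
  keeps a decay of exp (- (x - 1) ln 2) for x = n / k.\<close>

lemma weighted_exp_approx:
  assumes k: "1 \<le> k" "k \<le> n" and y: "real n - real k \<le> y" "y \<le> real n"
    and z: "real n - real k \<le> z" "\<bar>y - z\<bar> \<le> 1"
  defines "l \<equiv> decision_rate k"
  shows "\<bar>real n * (l / real k * exp (- (l / real k) * y)) - real n * (c / real k * exp (- (c / real k) * z))\<bar>
    \<le> pointwise_const / real n"
proof -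
  define x where "x = real n / real k"
  have x: "1 \<le> x" using k by (simp add: x_def)
  have kn: "inverse (real k) = x / real n" using k by (simp add: x_def field_simps)
  have l: "ln 2 \<le> l" "l \<le> c" "c - l \<le> exp c / real k"
    using decision_rate_ge_ln2 decision_rate_le decision_rate_ge k by (auto simp: l_def)
  have l0: "0 \<le> l" using l ln2_pos by linarith
  have yk: "x - 1 \<le> y / real k" "x - 1 \<le> z / real k" "y / real k \<le> x"
    using k y z divide_right_mono[of "real n - real k" y "real k"]
      divide_right_mono[of "real n - real k" z "real k"]
    by (auto simp: x_def diff_divide_distrib divide_right_mono)
  let ?e = "2 * exp (- (ln 2 * x))"
  have e: "?e = exp (- (ln 2 * (x - 1)))"
    by (simp add: algebra_simps exp_diff exp_minus divide_inverse)
  have wy: "ln 2 * (x - 1) \<le> l * (y / real k)" and wz: "ln 2 * (x - 1) \<le> c * (z / real k)"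
    using l ln2_le_c yk x l0 c_pos by (intro mult_mono; simp)+
  have ckl: "0 \<le> c - l" "c - l \<le> exp c * x / real n" using l kn by (auto simp: divide_inverse)
  have d: "\<bar>l * (y / real k) - c * (z / real k)\<bar> \<le> (exp c * x ^ 2 + c * x) / real n"
  proof -
    have "l * (y / real k) - c * (z / real k) = - (c - l) * (y / real k) + c * inverse (real k) * (y - z)"
      by (simp add: divide_inverse algebra_simps)
    moreover have "\<bar>- (c - l) * (y / real k)\<bar> \<le> exp c * x / real n * x"
    proof -
      have y0: "0 \<le> y / real k" using yk x by linarith
      then have "\<bar>- (c - l) * (y / real k)\<bar> = (c - l) * (y / real k)"
        using ckl(1) by (simp only: abs_mult abs_minus_cancel abs_of_nonneg)
      also have "\<dots> \<le> exp c * x / real n * x" using ckl yk y0 x by (intro mult_mono) auto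
      finally show ?thesis .
    qed
    moreover have "\<bar>c * inverse (real k) * (y - z)\<bar> \<le> c * (x / real n) * 1"
      using z c_pos x unfolding abs_mult kn by (intro mult_mono) auto
    moreover have "(exp c * x ^ 2 + c * x) / real n = exp c * x / real n * x + c * (x / real n) * 1"
      by (simp add: power2_eq_square add_divide_distrib)
    ultimately show ?thesis by linarith
  qed
  \<comment> \<open>The rate is replaced first in the prefactor, then in the exponential.\<close>
  have split: "real n * (l / real k * exp (- (l / real k) * y)) - real n * (c / real k * exp (- (c / real k) * z))
      = - x * (c - l) * exp (- (l * (y / real k))) + x * c * (exp (- (l * (y / real k))) - exp (- (c * (z / real k))))"
    by (simp add: x_def algebra_simps diff_divide_distrib)
  have fst: "\<bar>- x * (c - l) * exp (- (l * (y / real k)))\<bar> \<le> x * (exp c * x / real n) * ?e"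
    using x ckl wy unfolding abs_mult e by (intro mult_mono) auto
  have snd: "\<bar>x * c * (exp (- (l * (y / real k))) - exp (- (c * (z / real k))))\<bar>
      \<le> x * c * (?e * ((exp c * x ^ 2 + c * x) / real n))"
  proof -
    have "\<bar>exp (- (l * (y / real k))) - exp (- (c * (z / real k)))\<bar>
      \<le> exp (- (ln 2 * (x - 1))) * \<bar>l * (y / real k) - c * (z / real k)\<bar>"
      by (intro exp_minus_diff_le wy wz)
    also have "\<dots> \<le> ?e * ((exp c * x ^ 2 + c * x) / real n)"
      unfolding e by (intro mult_left_mono d) auto
    finally have "x * c * \<bar>exp (- (l * (y / real k))) - exp (- (c * (z / real k)))\<bar>
        \<le> x * c * (?e * ((exp c * x ^ 2 + c * x) / real n))"
      using x c_pos by (intro mult_left_mono) auto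
    moreover have "0 \<le> x * c" using x c_pos by simp
    ultimately show ?thesis by (simp only: abs_mult[of "x * c"] abs_of_nonneg)
  qed
  have tri: "\<bar>a\<bar> \<le> u + v" if "a = b + d" "\<bar>b\<bar> \<le> u" "\<bar>d\<bar> \<le> v" for a b d u v :: real
    using that by linarith
  have "\<bar>real n * (l / real k * exp (- (l / real k) * y)) - real n * (c / real k * exp (- (c / real k) * z))\<bar>
    \<le> x * (exp c * x / real n) * ?e + x * c * (?e * ((exp c * x ^ 2 + c * x) / real n))"
    by (rule tri[OF split fst snd])
  also have "\<dots> = 2 * (exp c * (x ^ 2 * exp (- (ln 2 * x))) + c * exp c * (x ^ 3 * exp (- (ln 2 * x)))
      + c ^ 2 * (x ^ 2 * exp (- (ln 2 * x)))) / real n"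
    by (simp add: power2_eq_square power3_eq_cube algebra_simps add_divide_distrib)
  also have "\<dots> \<le> 2 * (exp c * decay_const + c * exp c * decay_const + c ^ 2 * decay_const) / real n"
    using power_exp_le[OF x] c_pos
    by (intro divide_right_mono mult_left_mono add_mono) auto
  also have "\<dots> = pointwise_const / real n" by (simp add: pointwise_const_def algebra_simps)
  finally show ?thesis .
qed

text \<open>The exponents i - 1 and n bound a segment of length n - i + 1, exactly the denominator,
  so the segment form removes it. The limit, scaled by n, runs over the segment from i to n, which
  may shrink to a point at i = n.\<close>

lemma decision_number_exp_mean_approx:
  assumes j: "1 \<le> j" "j < i" "i \<le> n"
  defines "d \<equiv> decision_number (n - j)"
  shows "\<bar>real n / real (n - i + 1) * (d ^ (i - 1) - d ^ n) - exp_mean (real i / real n) (1 / (1 - real j / real n))\<bar>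
    \<le> pointwise_const / real n"
proof -
  define k m where "k = n - j" and "m = decision_rate k / real k"
  have k: "1 \<le> k" "k \<le> n" "real n - real k = real j" using j by (auto simp: k_def)
  have dk: "d = exp (- m)" using k decision_number_eq_exp[of k] by (simp add: d_def m_def k_def)
  have pw: "d ^ l = exp (- m * real l)" for l
    by (simp add: dk mult.commute flip: exp_of_nat_mult)
  define a where "a = real i - 1"
  have a: "real (i - 1) = a" "real (n - i + 1) = real n - a" "0 < real n - a" using j by (auto simp: a_def)
  have "((\<lambda>v. real n / (real n - a) * ((real n - a) * (m * exp (- m * (a + v * (real n - a)))))) has_integral
      real n / (real n - a) * (exp (- m * a) - exp (- m * real n))) {0..1}"
    by (intro has_integral_mult_right has_integral_exp_segment)
  then have 1: "real n / real (n - i + 1) * (d ^ (i - 1) - d ^ n)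
      = integral {0..1} (\<lambda>v. real n * (m * exp (- m * (a + v * (real n - a)))))"
    using a(3) unfolding pw a(1,2) by (intro integral_unique[symmetric]) simp
  have "1 / (1 - real j / real n) = real n / real k" using k j by (simp add: field_simps)
  then have 2: "exp_mean (real i / real n) (1 / (1 - real j / real n))
      = integral {0..1} (\<lambda>v. real n * (c / real k * exp (- (c / real k) * (real i + v * (real n - real i)))))"
  proof -
    have "c * (real n / real k) * exp (- (c * (real n / real k) * (real i / real n + v * (1 - real i / real n))))
        = real n * (c / real k * exp (- (c / real k) * (real i + v * (real n - real i))))" for v
    proof -
      have "real n * (real i / real n + v * (1 - real i / real n)) = real i + v * (real n - real i)"
        using j by (simp add: field_simps)
      then have "c * (real n / real k) * (real i / real n + v * (1 - real i / real n))
          = c / real k * (real i + v * (real n - real i))"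
        by (metis (no_types, lifting) mult.assoc times_divide_eq_left times_divide_eq_right)
      then show ?thesis by simp
    qed
    then show ?thesis
      by (simp only: exp_mean_def \<open>1 / (1 - real j / real n) = real n / real k\<close>)
  qed
  show ?thesis unfolding 1 2
  proof (rule integral_diff_le_const)
    fix v :: real assume v: "0 \<le> v" "v \<le> 1"
    have "v * (real n - a) \<le> 1 * (real n - a)" using v a by (intro mult_right_mono) auto
    moreover have "0 \<le> v * (real n - a)" "0 \<le> v * (real n - real i)" using v a j by auto
    moreover have "real j \<le> a" using j by (simp add: a_def)
    moreover have "a + v * (real n - a) - (real i + v * (real n - real i)) = v - 1"
      by (simp add: a_def algebra_simps)
    ultimately show "\<bar>real n * (m * exp (- m * (a + v * (real n - a)))) -
         real n * (c / real k * exp (- (c / real k) * (real i + v * (real n - real i))))\<bar> \<le> pointwise_const / real n"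
      unfolding m_def using k v j by (intro weighted_exp_approx) auto
  qed (use k in \<open>auto intro!: continuous_intros\<close>)
qed

lemma final_term_approx:
  assumes "1 \<le> i" "i \<le> n"
  shows "\<bar>decision_number (n - i) ^ n - final_term (real i / real n)\<bar> \<le> decay_const * exp c / real n"
\<comment> \<open>At i = n both \<open>decision_number 0\<close> and \<open>final_term 1\<close>
  vanish.\<close>
proof (cases "i = n")
  case True
  then show ?thesis using assms decay_const_nonneg by (simp add: final_term_def power_0_left)
next
  case False
  then have "c / (1 - real i / real n) = c * real n / real (n - i)" using assms by (simp add: field_simps)
  moreover have "real i / real n \<noteq> 1" using False assms by simp
  ultimately have "final_term (real i / real n) = exp (- c * real n / real (n - i))"
    by (simp add: final_term_def)
  then show ?thesis using decision_number_power_approx[of "n - i" n] False assms by simp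
qed

section \<open>Lipschitz bound for the density, uniform in t\<close>

definition lipschitz_const :: real where
  "lipschitz_const = c * decay_const + 2 * c * (1 + c) * decay_const"

lemma lipschitz_const_nonneg: "0 \<le> lipschitz_const"
  using c_pos decay_const_nonneg by (simp add: lipschitz_const_def)

text \<open>With x = 1 / (1 - u) the derivative in u is c x^2 exp (- c x y) (1 - c x y), of third
  order in x. Since y \<ge> t \<ge> u, the exponent satisfies x y \<ge> x u = x - 1, so the decay
  beats x^3 even near u = 1.\<close>

lemma weighted_exp_lipschitz:
  assumes t: "t \<le> y" "y \<le> 1" and s: "0 \<le> s" "s \<le> t" "s < 1" and r: "0 \<le> r" "r \<le> t" "r < 1"
  shows "\<bar>c / (1 - s) * exp (- (c / (1 - s) * y)) - c / (1 - r) * exp (- (c / (1 - r) * y))\<bar>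
    \<le> 2 * c * (1 + c) * decay_const * \<bar>s - r\<bar>"
proof -
  let ?f = "\<lambda>u. c / (1 - u) * exp (- (c / (1 - u) * y))"
  let ?f' = "\<lambda>u. c / (1 - u) ^ 2 * exp (- (c / (1 - u) * y)) * (1 - c / (1 - u) * y)"
  have deriv: "(?f has_field_derivative ?f' u) (at u within {min s r..max s r})"
    if "u \<in> {min s r..max s r}" for u
  proof -
    have "u < 1" using that s r by (auto simp: max_def split: if_splits)
    then show ?thesis
      by (auto intro!: derivative_eq_intros simp: power2_eq_square divide_simps) (simp add: algebra_simps)
  qed
  have bound: "norm (?f' u) \<le> 2 * c * (1 + c) * decay_const" if "u \<in> {min s r..max s r}" for u
  proof -
    have u: "0 \<le> u" "u \<le> t" "u < 1" using that s r by (auto simp: max_def min_def split: if_splits)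
    define x where "x = 1 / (1 - u)"
    have x: "1 \<le> x" using u by (simp add: x_def)
    have xy: "x - 1 \<le> x * y" "x * y \<le> x"
    proof -
      have "x - 1 = x * u" using u by (simp add: x_def field_simps)
      also have "\<dots> \<le> x * y" using u t x by (intro mult_left_mono) auto
      finally show "x - 1 \<le> x * y" .
      show "x * y \<le> x" using x t by (simp add: mult_left_le)
    qed
    have "exp (- (c * (x * y))) \<le> exp (- (ln 2 * (x - 1)))"
      using xy x ln2_le_c by (simp, intro mult_mono) (use c_pos in auto)
    also have "\<dots> = 2 * exp (- (ln 2 * x))" by (simp add: algebra_simps exp_diff exp_minus divide_inverse)
    finally have e: "exp (- (c * (x * y))) \<le> 2 * exp (- (ln 2 * x))" .
    have "\<bar>1 - c * (x * y)\<bar> \<le> 1 + c * x"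
    proof -
      have "c * (x * y) \<le> c * x" "0 \<le> c * (x * y)" using xy x c_pos by (auto intro: mult_left_mono)
      moreover have "0 \<le> c * x" using x c_pos by simp
      ultimately show ?thesis by linarith
    qed
    also have "\<dots> \<le> (1 + c) * x" using x by (simp add: algebra_simps)
    finally have l: "\<bar>1 - c * (x * y)\<bar> \<le> (1 + c) * x" .
    have "?f' u = c * x ^ 2 * exp (- (c * (x * y))) * (1 - c * (x * y))"
      by (simp add: x_def power_divide)
    then have "norm (?f' u) = c * x ^ 2 * exp (- (c * (x * y))) * \<bar>1 - c * (x * y)\<bar>"
      using c_pos by (simp add: abs_mult)
    also have "\<dots> \<le> c * x ^ 2 * (2 * exp (- (ln 2 * x))) * ((1 + c) * x)"
      using c_pos e l by (intro mult_mono) auto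
    also have "\<dots> = 2 * c * (1 + c) * (x ^ 3 * exp (- (ln 2 * x)))"
      by (simp add: power2_eq_square power3_eq_cube)
    also have "\<dots> \<le> 2 * c * (1 + c) * decay_const"
      using c_pos power_exp_le[OF x, of 3] by (intro mult_left_mono) auto
    finally show ?thesis .
  qed
  show ?thesis
    using field_differentiable_bound[OF _ deriv bound, of s r] by (auto simp: min_def max_def)
qed

lemma exp_lipschitz:
  assumes s: "0 \<le> s" "s < 1" and r: "0 \<le> r" "r < 1"
  shows "\<bar>exp (- c / (1 - s)) - exp (- c / (1 - r))\<bar> \<le> c * decay_const * \<bar>s - r\<bar>"
proof -
  have deriv: "((\<lambda>u. exp (- c / (1 - u))) has_field_derivative - c / (1 - u) ^ 2 * exp (- c / (1 - u)))
      (at u within {min s r..max s r})" if "u \<in> {min s r..max s r}" for u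
  proof -
    have "u < 1" using that s r by (auto simp: max_def split: if_splits)
    then show ?thesis by (auto intro!: derivative_eq_intros simp: power2_eq_square)
  qed
  have bound: "norm (- c / (1 - u) ^ 2 * exp (- c / (1 - u))) \<le> c * decay_const"
    if "u \<in> {min s r..max s r}" for u
  proof -
    have u: "0 \<le> u" "u < 1" using that s r by (auto simp: max_def min_def split: if_splits)
    define x where "x = 1 / (1 - u)"
    have x: "1 \<le> x" using u by (simp add: x_def)
    have "- c / (1 - u) ^ 2 * exp (- c / (1 - u)) = - (c * (x ^ 2 * exp (- (c * x))))"
      by (simp add: x_def power_divide)
    then have "norm (- c / (1 - u) ^ 2 * exp (- c / (1 - u))) = c * (x ^ 2 * exp (- (c * x)))"
      using c_pos by (simp add: abs_mult)
    also have "\<dots> \<le> c * (x ^ 2 * exp (- (ln 2 * x)))"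
      using c_pos ln2_le_c x by (intro mult_left_mono) auto
    also have "\<dots> \<le> c * decay_const"
      using c_pos power_exp_le[OF x, of 2] by (intro mult_left_mono) auto
    finally show ?thesis .
  qed
  show ?thesis
    using field_differentiable_bound[OF _ deriv bound, of s r] s r by (auto simp: min_def max_def split: if_splits)
qed

lemma weight_density_lipschitz:
  assumes "t \<le> 1" and s: "0 \<le> s" "s \<le> t" "s < 1" and r: "0 \<le> r" "r \<le> t" "r < 1"
  shows "\<bar>weight_density t s - weight_density t r\<bar> \<le> lipschitz_const * \<bar>s - r\<bar>"
proof -
  have "\<bar>exp_mean t (1 / (1 - s)) - exp_mean t (1 / (1 - r))\<bar> \<le> 2 * c * (1 + c) * decay_const * \<bar>s - r\<bar>"
    unfolding exp_mean_def
  proof (rule integral_diff_le_const)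
    fix v :: real assume v: "0 \<le> v" "v \<le> 1"
    have "v * (1 - t) \<le> 1 * (1 - t)" using v assms by (intro mult_right_mono) auto
    then have "t \<le> t + v * (1 - t)" "t + v * (1 - t) \<le> 1" using v assms by auto
    from weighted_exp_lipschitz[OF this s r]
    show "\<bar>c * (1 / (1 - s)) * exp (- (c * (1 / (1 - s)) * (t + v * (1 - t)))) -
         c * (1 / (1 - r)) * exp (- (c * (1 / (1 - r)) * (t + v * (1 - t))))\<bar>
         \<le> 2 * c * (1 + c) * decay_const * \<bar>s - r\<bar>" by simp
  qed (use s r in \<open>auto intro!: continuous_intros\<close>)
  then show ?thesis
    using exp_lipschitz[of s r] s r
    unfolding weight_density_def lipschitz_const_def distrib_right by linarith
qed

section \<open>Primitive of the density and closed form of the weight\<close>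

lemma exp_int_continuous:
  assumes "0 < a"
  shows "continuous_on {a..b} (\<lambda>u. exp_int u a)"
  unfolding exp_int_def using assms
  by (intro indefinite_integral_continuous_1 integrable_continuous_interval continuous_intros) auto

lemma exp_int_deriv:
  assumes "0 < a" "a < u"
  shows "((\<lambda>u. exp_int u a) has_real_derivative exp (- u) / u) (at u)"
proof -
  have "((\<lambda>u. exp_int u a) has_real_derivative exp (- u) / u) (at u within {a..u + 1})"
    unfolding exp_int_def using assms
    by (intro integral_has_real_derivative continuous_intros) auto
  moreover have "at u within {a..u + 1} = at u"
    using assms by (intro at_within_interior) auto
  ultimately show ?thesis by simp
qed

text \<open>Primitive of exp (- a / (1 - s)): integration by parts leaves a exp (- a / (1 - s)) / (1
  - s), and \<xi> = a / (1 - s) turns this into the exponential integral, started at a so as to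
  vanish for s = 0.\<close>

definition exp_antideriv :: "real \<Rightarrow> real \<Rightarrow> real" where
  "exp_antideriv a s = - (1 - s) * exp (- a / (1 - s)) - a * exp_int (a / (1 - s)) a"

lemma one_minus_exp_deriv:
  assumes "s < 1"
  shows "((\<lambda>s. - (1 - s) * exp (- a / (1 - s))) has_real_derivative
      exp (- a / (1 - s)) + a / (1 - s) * exp (- a / (1 - s))) (at s)"
proof -
  define e where "e = exp (- a / (1 - s))"
  have "((\<lambda>s. - (1 - s) * exp (- a / (1 - s))) has_real_derivative
      1 * e + (- (1 - s)) * (e * (- a / (1 - s) ^ 2))) (at s)"
    unfolding e_def using assms
    by (auto intro!: derivative_eq_intros simp: power2_eq_square)
  moreover have "1 * e + (- (1 - s)) * (e * (- a / (1 - s) ^ 2)) = e + a / (1 - s) * e"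
    using assms by (simp add: power2_eq_square divide_simps) (simp add: algebra_simps)
  ultimately show ?thesis unfolding e_def by (simp only:)
qed

lemma exp_antideriv_deriv:
  assumes "0 < a" "0 < s" "s < 1"
  shows "(exp_antideriv a has_real_derivative exp (- a / (1 - s))) (at s)"
proof -
  have "a < a / (1 - s)" using assms by (simp add: field_simps)
  from exp_int_deriv[OF assms(1) this]
  have "((\<lambda>s. exp_int (a / (1 - s)) a) has_real_derivative
      exp (- (a / (1 - s))) / (a / (1 - s)) * (a / (1 - s) ^ 2)) (at s)"
    using assms by (intro DERIV_chain2[of "\<lambda>u. exp_int u a"])
      (auto intro!: derivative_eq_intros simp: power2_eq_square)
  moreover have "exp (- (a / (1 - s))) / (a / (1 - s)) * (a / (1 - s) ^ 2) = exp (- a / (1 - s)) / (1 - s)"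
    using assms by (simp add: power2_eq_square)
  ultimately have 1: "((\<lambda>s. a * exp_int (a / (1 - s)) a) has_real_derivative a * (exp (- a / (1 - s)) / (1 - s))) (at s)"
    by (intro DERIV_cmult) simp
  have 2: "((\<lambda>s. - (1 - s) * exp (- a / (1 - s))) has_real_derivative
      exp (- a / (1 - s)) + a / (1 - s) * exp (- a / (1 - s))) (at s)"
    using assms by (intro one_minus_exp_deriv) auto
  show ?thesis
    using DERIV_diff[OF 2 1] unfolding exp_antideriv_def by simp
qed

lemma exp_antideriv_continuous:
  assumes "0 < a" "t < 1"
  shows "continuous_on {0..t} (exp_antideriv a)"
proof -
  have "continuous_on {0..t} (\<lambda>s. exp_int (a / (1 - s)) a)"
    using assms
    by (intro continuous_on_compose2[OF exp_int_continuous[of a "a / (1 - t)"]] continuous_intros)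
       (auto simp: field_simps intro!: mult_left_mono)
  then show ?thesis
    unfolding exp_antideriv_def using assms by (intro continuous_intros) auto
qed

text \<open>At t = 1 the density is exp (- c / (1 - s)) (1 + c / (1 - s)), which has an elementary
  primitive; otherwise the explicit form of \<open>exp_mean\<close> reduces everything to
  \<open>exp_antideriv\<close> with parameters c and c t.\<close>

definition weight_density_antideriv :: "real \<Rightarrow> real \<Rightarrow> real" where
  "weight_density_antideriv t s = (if t = 1 then - (1 - s) * exp (- c / (1 - s))
     else exp_antideriv c s - final_term t * s + (exp_antideriv (c * t) s - exp_antideriv c s) / (1 - t))"

lemma weight_density_antideriv_deriv:
  assumes "0 < t" "t \<le> 1" "0 < s" "s < t"
  shows "(weight_density_antideriv t has_real_derivative weight_density t s) (at s)"
proof (cases "t = 1")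
  case True
  then have "weight_density_antideriv t = (\<lambda>s. - (1 - s) * exp (- c / (1 - s)))"
    by (simp add: weight_density_antideriv_def fun_eq_iff)
  moreover have "((\<lambda>s. - (1 - s) * exp (- c / (1 - s))) has_real_derivative
      exp (- c / (1 - s)) + c / (1 - s) * exp (- c / (1 - s))) (at s)"
    using assms by (intro one_minus_exp_deriv) auto
  ultimately show ?thesis using True by (simp add: weight_density_def final_term_def exp_mean_1)
next
  case False
  then have t: "t < 1" using assms by simp
  have 1: "(exp_antideriv c has_real_derivative exp (- c / (1 - s))) (at s)"
    and 2: "(exp_antideriv (c * t) has_real_derivative exp (- (c * t) / (1 - s))) (at s)"
    using assms t c_pos exp_antideriv_deriv[of c s] exp_antideriv_deriv[of "c * t" s] by auto
  have eq: "weight_density_antideriv t =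
      (\<lambda>s. exp_antideriv c s - final_term t * s + (exp_antideriv (c * t) s - exp_antideriv c s) / (1 - t))"
    using False by (simp add: weight_density_antideriv_def fun_eq_iff)
  have "(weight_density_antideriv t has_real_derivative exp (- c / (1 - s)) - final_term t * 1
      + (exp (- (c * t) / (1 - s)) - exp (- c / (1 - s))) / (1 - t)) (at s)"
    unfolding eq by (intro DERIV_add DERIV_diff DERIV_cdivide DERIV_cmult 1 2 DERIV_ident)
  then show ?thesis by (simp add: weight_density_def exp_mean_eq[OF t])
qed

lemma weight_density_antideriv_continuous:
  assumes "0 < t" "t \<le> 1"
  shows "continuous_on {0..t} (weight_density_antideriv t)"
proof (cases "t = 1")
  case True
  have "((\<lambda>s. - (1 - s) * exp (- c / (1 - s))) \<longlongrightarrow> - (1 - s) * exp (- c / (1 - s))) (at s within {0..1})"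
    if s: "s \<in> {0..1}" for s
  proof (cases "s = 1")
    case True
    \<comment> \<open>At s = 1 division by zero turns the exponential into 1, but the factor 1 - s
      vanishes, so the value 0 is still the limit.\<close>
    have "((\<lambda>s. 1 - s) \<longlongrightarrow> 1 - 1) (at (1::real) within {0..1})" by (intro tendsto_intros)
    then have lim: "((\<lambda>s. 1 - s) \<longlongrightarrow> 0) (at (1::real) within {0..1})" by simp
    have "norm (- (1 - r) * exp (- c / (1 - r))) \<le> 1 - r" if "r \<in> {0..1}" for r
      using that c_pos by (auto simp: abs_mult intro!: mult_left_le)
    then have "eventually (\<lambda>r. norm (- (1 - r) * exp (- c / (1 - r))) \<le> 1 - r) (at 1 within {0..1})"
      by (auto simp: eventually_at_filter)
    from Lim_null_comparison[OF this lim] show ?thesis using True by simp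
  next
    case False
    then show ?thesis using s by (intro tendsto_intros) auto
  qed
  then show ?thesis using True
    by (simp add: continuous_on_def weight_density_antideriv_def)
next
  case False
  then have "t < 1" using assms by simp
  then show ?thesis
    using False assms c_pos unfolding weight_density_antideriv_def
    by (auto intro!: continuous_intros exp_antideriv_continuous)
qed

text \<open>For t < 1 the terms exp (- c / (1 - t)) from the boundary values of the primitive cancel
  against \<open>final_term\<close>. What remains is a rational identity once the exponentials and
  exponential integrals are named as atoms.\<close>

lemma limit_weight_eq_average:
  assumes "0 < t" "t \<le> 1"
  shows "limit_weight c t = (weight_density_antideriv t t - weight_density_antideriv t 0) / t"
proof (cases "t = 1")
  case True
  then show ?thesis by (simp add: limit_weight_def weight_density_antideriv_def)
next
  case False
  define J where "J = exp_int (c / (1 - t)) c"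
  define K where "K = exp_int (c * t / (1 - t)) (c * t)"
  define e1 e2 e3 e4 where "e1 = exp (- c)" "e2 = exp (- c * t)"
    "e3 = exp (- c * t / (1 - t))" "e4 = exp (- c / (1 - t))"
  note folds = J_def[symmetric] K_def[symmetric] e1_e2_e3_e4_def[symmetric]
  have t: "0 < t" "0 < 1 - t" using assms False by auto
  have z: "exp_int c c = 0" "exp_int (c * t) (c * t) = 0" by (simp_all add: exp_int_def)
  have A: "exp_antideriv c t = - (1 - t) * e4 - c * J" "exp_antideriv c 0 = - e1"
    "exp_antideriv (c * t) t = - (1 - t) * e3 - c * t * K" "exp_antideriv (c * t) 0 = - e2"
    by (simp_all add: exp_antideriv_def z folds) (simp_all add: e1_e2_e3_e4_def)
  have "limit_weight c t = - e1 + (e2 - e3) / t + (e2 - t * e1) / (1 - t) + c / (1 - t) * (J - K)"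
    using t by (simp add: limit_weight_def e1_e2_e3_e4_def J_def K_def)
  also have "\<dots> = ((- (1 - t) * e4 - c * J) - e4 * t + ((- (1 - t) * e3 - c * t * K) - (- (1 - t) * e4 - c * J)) / (1 - t)
      - (- e1 + (- e2 + e1) / (1 - t))) / t"
  proof -
    have "(1 - t) * (t * (- e1 + (e2 - e3) / t + (e2 - t * e1) / (1 - t) + c / (1 - t) * (J - K)))
      = (1 - t) * ((- (1 - t) * e4 - c * J) - e4 * t + ((- (1 - t) * e3 - c * t * K) - (- (1 - t) * e4 - c * J)) / (1 - t)
      - (- e1 + (- e2 + e1) / (1 - t)))"
      using t by (simp add: divide_simps) (simp add: algebra_simps)
    then show ?thesis using t by (simp add: eq_divide_eq mult.commute)
  qed
  also have "\<dots> = (weight_density_antideriv t t - weight_density_antideriv t 0) / t"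
    using False by (simp add: weight_density_antideriv_def A final_term_def e1_e2_e3_e4_def)
  finally show ?thesis .
qed

text \<open>The summands account for the two powers d(n - j)^n and d(n - i)^n, the difference of
  powers, the Riemann sum, and the passage from t = 1 / n to t = 0 when i = 1.\<close>

definition error_const :: real where
  "error_const = 2 * decay_const * exp c + pointwise_const + lipschitz_const + c ^ 2"

lemma stop_weight_approx:
  assumes n: "2 \<le> n" and i: "1 \<le> i" "i \<le> n"
  shows "\<bar>limit_weight c (real i / real n) - stop_weight n i\<bar> \<le> error_const / real n"
proof -
  define t where "t = real i / real n"
  have t: "0 < t" "t \<le> 1" using i by (auto simp: t_def)
  have nonneg: "0 \<le> decay_const * exp c / real n" "0 \<le> pointwise_const / real n" "0 \<le> c ^ 2 / real n"
    "0 \<le> lipschitz_const / real n"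
    using decay_const_nonneg c_pos lipschitz_const_nonneg by (auto simp: pointwise_const_def)
  have err: "error_const / real n = 2 * (decay_const * exp c / real n) + pointwise_const / real n
      + lipschitz_const / real n + c ^ 2 / real n"
    by (simp add: error_const_def add_divide_distrib)
  have E: "\<bar>decision_number (n - i) ^ n - final_term t\<bar> \<le> decay_const * exp c / real n"
    using final_term_approx[OF i] by (simp add: t_def)
  show ?thesis
  proof (cases "i = 1")
    case True
    have t1: "t < 1" using True n by (simp add: t_def)
    \<comment> \<open>For i = 1 the average would be empty. The mean value theorem makes w(t) one
      value of the density, at some z < 1 / n, and z is then moved to 0. There, once
      \<open>exp_mean t 1\<close> is replaced by \<open>exp_mean 0 1\<close> = 1 - exp (- c), the
      density is 1 - \<open>final_term t\<close>.\<close>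
    have "\<exists>l z. 0 < z \<and> z < t \<and> DERIV (weight_density_antideriv t) z :> l
        \<and> weight_density_antideriv t t - weight_density_antideriv t 0 = (t - 0) * l"
      using t weight_density_antideriv_continuous[OF t] weight_density_antideriv_deriv[OF t]
      by (intro MVT) (auto simp: real_differentiable_def)
    then obtain l z where z: "0 < z" "z < t" and l: "DERIV (weight_density_antideriv t) z :> l"
      and eq: "weight_density_antideriv t t - weight_density_antideriv t 0 = t * l" by auto
    have "l = weight_density t z" using DERIV_unique[OF l weight_density_antideriv_deriv[OF t z]] .
    then have lw: "limit_weight c t = weight_density t z"
      using t eq by (simp add: limit_weight_eq_average)
    have "\<bar>weight_density t z - weight_density t 0\<bar> \<le> lipschitz_const * \<bar>z - 0\<bar>"
      using t t1 z by (intro weight_density_lipschitz) auto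
    also have "\<dots> \<le> lipschitz_const * t" using z lipschitz_const_nonneg by (intro mult_left_mono) auto
    finally have 1: "\<bar>weight_density t z - weight_density t 0\<bar> \<le> lipschitz_const / real n"
      using True by (simp add: t_def)
    have 2: "\<bar>exp_mean t 1 - exp_mean 0 1\<bar> \<le> c ^ 2 / real n"
      unfolding exp_mean_def
    proof (rule integral_diff_le_const)
      fix v :: real assume v: "0 \<le> v" "v \<le> 1"
      have "0 \<le> v * (1 - t)" using v t by simp
      then have "\<bar>exp (- (c * 1 * (t + v * (1 - t)))) - exp (- (c * 1 * (0 + v * (1 - 0))))\<bar>
          \<le> exp (- 0) * \<bar>c * 1 * (t + v * (1 - t)) - c * 1 * (0 + v * (1 - 0))\<bar>"
        using v t c_pos by (intro exp_minus_diff_le) auto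
      also have "\<dots> = c * (t * (1 - v))"
        using c_pos t v by (simp add: abs_if algebra_simps)
      also have "\<dots> \<le> c * t" using v t c_pos by (intro mult_left_mono mult_left_le) auto
      finally have "c * \<bar>exp (- (c * 1 * (t + v * (1 - t)))) - exp (- (c * 1 * (0 + v * (1 - 0))))\<bar> \<le> c * (c * t)"
        using c_pos by (intro mult_left_mono) auto
      moreover have "c * 1 * a - c * 1 * b = c * (a - b)" for a b :: real by (simp add: algebra_simps)
      moreover have "c * (c * t) = c ^ 2 / real n" using True by (simp add: t_def power2_eq_square)
      ultimately show "\<bar>c * 1 * exp (- (c * 1 * (t + v * (1 - t)))) - c * 1 * exp (- (c * 1 * (0 + v * (1 - 0))))\<bar> \<le> c ^ 2 / real n"
        using c_pos by (simp only: abs_mult abs_of_pos)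
    qed (auto intro!: continuous_intros)
    have "exp_mean 0 1 = 1 - exp (- c)" by (simp add: exp_mean_eq)
    moreover have "weight_density t 0 = exp (- c) - final_term t + exp_mean t 1" by (simp add: weight_density_def)
    moreover have "stop_weight n i = 1 - decision_number (n - i) ^ n" using True by (simp add: stop_weight_def)
    ultimately show ?thesis using 1 2 E nonneg unfolding t_def[symmetric] lw err by linarith
  next
    case False
    then have i2: "2 \<le> i" using i by simp
    have avg: "\<bar>(weight_density_antideriv t t - weight_density_antideriv t 0) / t
        - (\<Sum>j=1..<i. weight_density t (real j / real n)) / real (i - 1)\<bar> \<le> lipschitz_const / real n"
      using n i2 t
      by (intro average_approx weight_density_antideriv_continuous weight_density_antideriv_deriv weight_density_lipschitz)
         (auto simp: t_def[symmetric] lipschitz_const_nonneg)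
    define T where "T j = decision_number (n - j) ^ n - decision_number (n - i) ^ n
        + real n / real (n - i + 1) * (decision_number (n - j) ^ (i - 1) - decision_number (n - j) ^ n)" for j
    define D where "D = 2 * (decay_const * exp c / real n) + pointwise_const / real n"
    have T: "\<bar>T j - weight_density t (real j / real n)\<bar> \<le> D" if j: "j \<in> {1..<i}" for j
    proof -
      have "- c / (1 - real j / real n) = - c * real n / real (n - j)"
        using j i by (simp add: field_simps)
      moreover have "1 \<le> n - j" using j i by auto
      ultimately have "\<bar>decision_number (n - j) ^ n - exp (- c / (1 - real j / real n))\<bar> \<le> decay_const * exp c / real n"
        using decision_number_power_approx[of "n - j" n] j i by simp
      moreover have "\<bar>real n / real (n - i + 1) * (decision_number (n - j) ^ (i - 1) - decision_number (n - j) ^ n)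
          - exp_mean t (1 / (1 - real j / real n))\<bar> \<le> pointwise_const / real n"
        unfolding t_def using j i by (intro decision_number_exp_mean_approx) auto
      ultimately show ?thesis using E unfolding T_def D_def weight_density_def by linarith
    qed
    have "\<bar>(\<Sum>j=1..<i. T j) - (\<Sum>j=1..<i. weight_density t (real j / real n))\<bar> \<le> (\<Sum>j=1..<i. D)"
      unfolding sum_subtractf[symmetric] by (intro order_trans[OF sum_abs] sum_mono T)
    then have "\<bar>(\<Sum>j=1..<i. T j) - (\<Sum>j=1..<i. weight_density t (real j / real n))\<bar> / real (i - 1) \<le> real (i - 1) * D / real (i - 1)"
      by (intro divide_right_mono) auto
    then have S: "\<bar>(\<Sum>j=1..<i. T j) / real (i - 1) - (\<Sum>j=1..<i. weight_density t (real j / real n)) / real (i - 1)\<bar> \<le> D"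
      using i2 by (simp add: diff_divide_distrib[symmetric])
    have eq: "stop_weight n i = (\<Sum>j=1..<i. T j) / real (i - 1)"
      using False by (simp add: stop_weight_def T_def)
    have le: "D + lipschitz_const / real n \<le> error_const / real n"
      using nonneg unfolding err D_def by linarith
    have tri: "\<bar>a - s\<bar> \<le> e" if "\<bar>s - r\<bar> \<le> d" "\<bar>a - r\<bar> \<le> l" "d + l \<le> e" for a s r d l e :: real
      using that by linarith
    show ?thesis
      unfolding t_def[symmetric] limit_weight_eq_average[OF t] eq by (rule tri[OF S avg le])
  qed
qed

end

subsection \<open>Optimal stopping\<close>

abbreviation (input) unif01 :: "real measure" where
  "unif01 \<equiv> uniform_measure lborel {0..1}"

lemma prob_space_unif01: "prob_space unif01"
  by (rule prob_space_uniform_measure) auto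

lemma unif01_eq_density: "unif01 = density lborel (\<lambda>x. ennreal (indicator {0..1} x))"
  unfolding uniform_measure_def by (intro density_cong) (auto simp: indicator_def)

lemma AE_unif01I: "(AE x in lborel. x \<in> {0..1} \<longrightarrow> P x) \<Longrightarrow> AE x in unif01. P x"
  by (intro AE_uniform_measureI) auto

lemma AE_unif01: "AE x in unif01. 0 \<le> x \<and> x \<le> 1"
  by (intro AE_unif01I) auto

lemma AE_unif01_neq: "AE x in unif01. x \<noteq> a"
  using AE_lborel_singleton[of a] by (intro AE_unif01I) auto

lemma integral_unif01_power:
  assumes "0 \<le> a" "a \<le> b" "b \<le> 1"
  shows "(\<integral>x. indicator {a..b} x * x ^ k \<partial>unif01) = (b ^ Suc k - a ^ Suc k) / real (Suc k)"
proof -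
  have "(\<integral>x. indicator {a..b} x * x ^ k \<partial>unif01) = (\<integral>x. indicator {0..1} x *\<^sub>R (indicator {a..b} x * x ^ k) \<partial>lborel)"
    unfolding unif01_eq_density by (intro integral_density) auto
  also have "\<dots> = (\<integral>x. x ^ k * indicator {a..b} x \<partial>lborel)"
    using assms by (intro Bochner_Integration.integral_cong) (auto simp: indicator_def)
  also have "\<dots> = (b ^ Suc k - a ^ Suc k) / real (Suc k)" using assms by (intro integral_power)
  finally show ?thesis .
qed

lemma integrable_unif01_power:
  "integrable unif01 (\<lambda>x. indicator {a..b} x * x ^ k)"
proof -
  interpret U: prob_space unif01 by (rule prob_space_unif01)
  show ?thesis
    by (intro U.integrable_const_bound[where B = 1])
       (use AE_unif01 in \<open>auto simp: indicator_def power_le_one\<close>)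
qed

text \<open>On [d, x] the minimum is u below y and constant above y; the two closed intervals share
  only the null set {y}.\<close>

lemma integral_unif01_min:
  assumes d: "0 \<le> d" "d \<le> x" "x \<le> 1" "d \<le> e"
  defines "y \<equiv> min x e"
  shows "(\<integral>u. (if d \<le> u \<and> u \<le> x then u ^ r * min u e ^ l else 0) \<partial>unif01)
    = (y ^ Suc (r + l) - d ^ Suc (r + l)) / real (Suc (r + l)) + y ^ l * (x ^ Suc r - y ^ Suc r) / real (Suc r)"
proof -
  have y: "0 \<le> y" "d \<le> y" "y \<le> x" "y \<le> 1" using d by (auto simp: y_def)
  have "(\<integral>u. (if d \<le> u \<and> u \<le> x then u ^ r * min u e ^ l else 0) \<partial>unif01)
    = (\<integral>u. indicator {d..y} u * u ^ (r + l) + y ^ l * (indicator {y..x} u * u ^ r) \<partial>unif01)"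
  proof (intro integral_cong_AE)
    show "AE u in unif01. (if d \<le> u \<and> u \<le> x then u ^ r * min u e ^ l else 0)
        = indicator {d..y} u * u ^ (r + l) + y ^ l * (indicator {y..x} u * u ^ r)"
      using AE_unif01_neq[of y]
    proof eventually_elim
      case (elim u)
      then show ?case
        using d by (auto simp: y_def min_def indicator_def power_add split: if_splits)
    qed
  qed auto
  also have "\<dots> = (\<integral>u. indicator {d..y} u * u ^ (r + l) \<partial>unif01) + y ^ l * (\<integral>u. indicator {y..x} u * u ^ r \<partial>unif01)"
    by (subst Bochner_Integration.integral_add)
       (auto intro!: integrable_unif01_power integrable_mult_right)
  also have "\<dots> = (y ^ Suc (r + l) - d ^ Suc (r + l)) / real (Suc (r + l)) + y ^ l * (x ^ Suc r - y ^ Suc r) / real (Suc r)"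
    using d y by (simp add: integral_unif01_power)
  finally show ?thesis .
qed

section \<open>Dynamic programming values\<close>

primrec continuation_value :: "nat \<Rightarrow> real \<Rightarrow> real" where
  "continuation_value 0 = (\<lambda>m. 0)"
| "continuation_value (Suc k) =
     (\<lambda>m. \<integral>x. (if x < m then continuation_value k m else max (x ^ k) (continuation_value k x)) \<partial>unif01)"

text \<open>Value once x is seen, with k observations to come and before the decision: below the
  running maximum m it cannot win, while a record may be accepted, winning with probability x^k, or
  passed over. Its average is the continuation value one step earlier.\<close>

definition stage_value :: "nat \<Rightarrow> real \<Rightarrow> real \<Rightarrow> real" where
  "stage_value k m x = (if x < m then continuation_value k m else max (x ^ k) (continuation_value k x))"

lemma continuation_value_Suc: "continuation_value (Suc k) m = (\<integral>x. stage_value k m x \<partial>unif01)"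
  by (simp add: stage_value_def)

declare continuation_value.simps(2) [simp del]

lemma measurable_continuation_value [measurable]: "continuation_value k \<in> borel_measurable borel"
proof (induction k)
  case (Suc k)
  note [measurable] = Suc
  interpret U: prob_space unif01 by (rule prob_space_unif01)
  have [measurable]: "case_prod (stage_value k) \<in> borel_measurable (borel \<Otimes>\<^sub>M unif01)"
    unfolding stage_value_def by measurable
  then show ?case unfolding continuation_value_Suc[abs_def] by measurable
qed simp

lemma measurable_stage_value [measurable (raw)]:
  assumes [measurable]: "f \<in> borel_measurable M" "g \<in> borel_measurable M"
  shows "(\<lambda>x. stage_value k (f x) (g x)) \<in> borel_measurable M"
  unfolding stage_value_def by measurable

lemma continuation_value_bounds: "0 \<le> continuation_value k m \<and> continuation_value k m \<le> 1"
proof (induction k arbitrary: m)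
  case (Suc k)
  interpret U: prob_space unif01 by (rule prob_space_unif01)
  have ae: "AE x in unif01. 0 \<le> stage_value k m x \<and> stage_value k m x \<le> 1"
    using AE_unif01 by eventually_elim (use Suc in \<open>auto simp: stage_value_def max_def power_le_one\<close>)
  have "integrable unif01 (stage_value k m)"
    by (intro U.integrable_const_bound[where B = 1]) (use ae in auto)
  then show ?case
    unfolding continuation_value_Suc using ae by (auto intro!: integral_nonneg_AE U.integral_le_const)
qed simp

lemma continuation_value_nonneg [simp]: "0 \<le> continuation_value k m"
  and continuation_value_le_1 [simp]: "continuation_value k m \<le> 1"
  using continuation_value_bounds by auto

lemma stage_value_bounds:
  assumes "0 \<le> x" "x \<le> 1"
  shows "0 \<le> stage_value k m x" "stage_value k m x \<le> 1"
  using assms by (auto simp: stage_value_def max_def power_le_one)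

lemma integrable_unif01_bounded:
  assumes [measurable]: "f \<in> borel_measurable borel" and "\<And>x. 0 \<le> x \<Longrightarrow> x \<le> 1 \<Longrightarrow> \<bar>f x\<bar> \<le> B"
  shows "integrable unif01 (f :: real \<Rightarrow> real)"
proof -
  interpret U: prob_space unif01 by (rule prob_space_unif01)
  show ?thesis
    using AE_unif01 assms(2) by (intro U.integrable_const_bound[where B = B]) auto
qed

text \<open>This is the Bellman recursion with the choice removed: a record is always
  accepted.\<close>

lemma first_record_value_Suc_integral:
  assumes m: "0 \<le> m" "m \<le> 1"
  shows "first_record_value (Suc k) m = (\<integral>x. (if x < m then first_record_value k m else x ^ k) \<partial>unif01)"
proof -
  have "(\<integral>x. (if x < m then first_record_value k m else x ^ k) \<partial>unif01)
      = (\<integral>x. first_record_value k m * (indicator {0..m} x * x ^ 0) + indicator {m..1} x * x ^ k \<partial>unif01)"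
  proof (intro integral_cong_AE)
    show "AE x in unif01. (if x < m then first_record_value k m else x ^ k)
        = first_record_value k m * (indicator {0..m} x * x ^ 0) + indicator {m..1} x * x ^ k"
      using AE_unif01 AE_unif01_neq[of m] by eventually_elim (auto simp: indicator_def)
  qed auto
  also have "\<dots> = first_record_value k m * (\<integral>x. indicator {0..m} x * x ^ 0 \<partial>unif01) + (\<integral>x. indicator {m..1} x * x ^ k \<partial>unif01)"
    by (subst Bochner_Integration.integral_add)
       (auto intro!: integrable_unif01_power integrable_mult_right simp del: power_0)
  also have "\<dots> = first_record_value (Suc k) m"
    using m by (simp only: integral_unif01_power first_record_value_Suc) simp
  finally show ?thesis by simp
qed

lemma first_record_value_le_continuation_value:
  assumes m: "0 \<le> m" "m \<le> 1"
  shows "first_record_value k m \<le> continuation_value k m"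
  using m
proof (induction k arbitrary: m)
  case (Suc k)
  have "\<bar>if x < m then first_record_value k m else x ^ k\<bar> \<le> 1" if "0 \<le> x" "x \<le> 1" for x
    using Suc.IH[OF Suc.prems] first_record_value_nonneg[OF Suc.prems, of k] continuation_value_le_1[of k m] that
    by (auto simp: power_le_one simp del: continuation_value_le_1)
  then show ?case
    unfolding first_record_value_Suc_integral[OF Suc.prems] continuation_value_Suc
    using AE_unif01 Suc.IH[OF Suc.prems] stage_value_bounds
    by (intro integral_mono_AE integrable_unif01_bounded[where B = 1])
       (auto simp: stage_value_def)
qed simp

text \<open>The monotone case of optimal stopping: thresholds fall as observations run out and the
  maximum only grows, so from m \<ge> d(k) on every later record passes its own threshold. The
  maximum in the Bellman recursion is then always attained by accepting.\<close>

lemma continuation_value_eq: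
  assumes m: "decision_number k \<le> m" "m \<le> 1"
  shows "continuation_value k m = first_record_value k m"
  using m
proof (induction k arbitrary: m)
  case (Suc k)
  have m: "0 \<le> m" "decision_number k \<le> m"
    using Suc.prems decision_number_nonneg[of "Suc k"] decision_number_mono_Suc[of k] by auto
  show ?case
    unfolding first_record_value_Suc_integral[OF m(1) Suc.prems(2)] continuation_value_Suc
  proof (intro integral_cong_AE)
    show "AE x in unif01. stage_value k m x = (if x < m then first_record_value k m else x ^ k)"
      using AE_unif01
    proof eventually_elim
      case (elim x)
      then show ?case
        using Suc.IH[of m] Suc.IH[of x] first_record_value_le[of k x] m Suc.prems
        by (auto simp: stage_value_def max_def)
    qed
  qed auto
qed simp

text \<open>Below the threshold even the simple plan of taking the next record does better than
  accepting.\<close>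

lemma continuation_value_gt_power:
  assumes "0 \<le> x" "x < decision_number k"
  shows "x ^ k < continuation_value k x"
  using first_record_value_gt[OF assms] first_record_value_le_continuation_value[of x k]
    assms decision_number_less_1[of k] by linarith

lemma continuation_value_less_power:
  assumes "decision_number k < x" "x \<le> 1"
  shows "continuation_value k x < x ^ k"
  using first_record_value_less[OF assms(1)] continuation_value_eq[of k x] assms by simp

lemma continuation_value_le_power:
  assumes "decision_number k \<le> x" "x \<le> 1"
  shows "continuation_value k x \<le> x ^ k"
  using first_record_value_le[OF assms(1)] continuation_value_eq[of k x] assms by simp

text \<open>This makes accepting a non-record a strict loss while observations remain.\<close>

lemma continuation_value_pos:
  assumes "0 \<le> m" "m < 1" "1 \<le> k"
  shows "0 < continuation_value k m"
  using first_record_value_pos[of m "k - 1"] first_record_value_le_continuation_value[of m k] assms by simp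

text \<open>Starting from 0 makes the first observation a record, as observations are almost surely
  nonnegative.\<close>

primrec running_max :: "(nat \<Rightarrow> 'a \<Rightarrow> real) \<Rightarrow> nat \<Rightarrow> 'a \<Rightarrow> real" where
  "running_max X 0 = (\<lambda>\<omega>. 0)"
| "running_max X (Suc i) = (\<lambda>\<omega>. max (running_max X i \<omega>) (X (Suc i) \<omega>))"

lemma running_max_nonneg: "0 \<le> running_max X i \<omega>"
  by (induction i) auto

lemma running_max_less:
  assumes "\<And>j. 1 \<le> j \<Longrightarrow> X j \<omega> < b" "0 < b"
  shows "running_max X i \<omega> < b"
  using assms by (induction i) auto

lemma running_max_mono: "i \<le> j \<Longrightarrow> running_max X i \<omega> \<le> running_max X j \<omega>"
  by (rule lift_Suc_mono_le[of "\<lambda>i. running_max X i \<omega>"]) auto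

lemma le_running_max: "1 \<le> j \<Longrightarrow> j \<le> i \<Longrightarrow> X j \<omega> \<le> running_max X i \<omega>"
  using running_max_mono[of j i X \<omega>] by (cases j) auto

lemma running_max_eq_Max:
  assumes "1 \<le> i" "0 \<le> X 1 \<omega>"
  shows "Max ((\<lambda>j. X j \<omega>) ` {1..i}) = running_max X i \<omega>"
  using assms(1)
proof (induction i rule: dec_induct)
  case (step i)
  have "{1..Suc i} = insert (Suc i) {1..i}" by auto
  then have "Max ((\<lambda>j. X j \<omega>) ` {1..Suc i}) = max (X (Suc i) \<omega>) (Max ((\<lambda>j. X j \<omega>) ` {1..i}))"
    using step.hyps by (simp add: Max_insert)
  then show ?case using step.IH by (simp add: max.commute)
qed (use assms(2) in simp)

section \<open>Independent observations and their filtration\<close>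

locale uniform_sample = prob_space M for M :: "'a measure" +
  fixes X :: "nat \<Rightarrow> 'a \<Rightarrow> real"
  assumes indep: "indep_vars (\<lambda>_. borel) X {1..}"
    and unif: "\<And>i. i \<ge> 1 \<Longrightarrow> distr M lborel (X i) = unif01"
begin

abbreviation "F \<equiv> natural_filtration M X"
abbreviation "mx \<equiv> running_max X"

lemma measurable_X [measurable]: "1 \<le> i \<Longrightarrow> X i \<in> borel_measurable M"
  using indep by (auto simp: indep_vars_def)

lemma distr_X: "1 \<le> i \<Longrightarrow> distr M borel (X i) = unif01"
  using unif[of i] distr_cong[of M M borel lborel "X i" "X i"] by simp

lemma space_F [simp]: "space (F i) = space M"
  by (simp add: natural_filtration_def)

lemma sets_F: "sets (F i) = {(\<lambda>\<omega>. \<lambda>j\<in>{1..i}. X j \<omega>) -` A \<inter> space M | A. A \<in> sets (\<Pi>\<^sub>M j\<in>{1..i}. borel)}"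
  unfolding natural_filtration_def by (rule sets_vimage_algebra2) (auto simp: space_PiM)

lemma measurable_F_X:
  assumes "1 \<le> j" "j \<le> i"
  shows "X j \<in> borel_measurable (F i)"
proof -
  have "(\<lambda>\<omega>. \<lambda>j\<in>{1..i}. X j \<omega>) \<in> measurable (F i) (\<Pi>\<^sub>M j\<in>{1..i}. borel)"
    unfolding natural_filtration_def by (rule measurable_vimage_algebra1) (auto simp: space_PiM)
  then have "(\<lambda>\<omega>. (\<lambda>j\<in>{1..i}. X j \<omega>) j) \<in> borel_measurable (F i)"
    by (rule measurable_compose[OF _ measurable_component_singleton]) (use assms in auto)
  then show ?thesis using assms by simp
qed

lemma measurable_F_I: "(\<And>j. 1 \<le> j \<Longrightarrow> j \<le> i \<Longrightarrow> X j \<in> borel_measurable N) \<Longrightarrow> space N = space M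
    \<Longrightarrow> (\<lambda>\<omega>. \<omega>) \<in> measurable N (F i)"
  unfolding natural_filtration_def
  by (rule measurable_vimage_algebra2) (auto intro!: measurable_restrict)

lemma measurable_id_F [measurable]: "(\<lambda>\<omega>. \<omega>) \<in> measurable M (F i)"
  by (rule measurable_F_I) auto

lemma measurable_id_F_F: "i \<le> j \<Longrightarrow> (\<lambda>\<omega>. \<omega>) \<in> measurable (F j) (F i)"
  by (rule measurable_F_I) (auto intro: measurable_F_X)

lemma measurable_from_F: "f \<in> measurable (F i) N \<Longrightarrow> f \<in> measurable M N"
  using measurable_compose[OF measurable_id_F] .

lemma sets_F_mono:
  assumes A: "A \<in> sets (F i)" and "i \<le> j"
  shows "A \<in> sets (F j)"
proof -
  have "A \<inter> space M = A" using sets.sets_into_space[OF A] by auto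
  then show ?thesis using measurable_sets[OF measurable_id_F_F[OF \<open>i \<le> j\<close>] A] by (simp only: vimage_ident space_F)
qed

lemma sets_F_sets_M:
  assumes A: "A \<in> sets (F i)"
  shows "A \<in> sets M"
proof -
  have "A \<inter> space M = A" using sets.sets_into_space[OF A] by auto
  then show ?thesis using measurable_sets[OF measurable_id_F A] by (simp only: vimage_ident)
qed

lemma measurable_F_mx: "i \<le> j \<Longrightarrow> mx i \<in> borel_measurable (F j)"
  by (induction i) (auto intro!: borel_measurable_max measurable_F_X)

lemma indep_next:
  assumes A: "A \<in> sets (F i)" and B: "B \<in> sets borel"
  shows "prob (A \<inter> (X (Suc i) -` B \<inter> space M)) = prob A * prob (X (Suc i) -` B \<inter> space M)"
proof -
  let ?g = "\<lambda>\<omega>. \<lambda>j\<in>{1..i}. X j \<omega>" and ?h = "\<lambda>\<omega>. \<lambda>j\<in>{Suc i}. X j \<omega>"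
  have "indep_var (PiM {1..i} (\<lambda>_. borel)) ?g (PiM {Suc i} (\<lambda>_. borel)) ?h"
    by (rule indep_var_restrict[OF indep]) auto
  then have ind: "indep_set (sigma_sets (space M) {?g -` A \<inter> space M | A. A \<in> sets (PiM {1..i} (\<lambda>_. borel))})
      (sigma_sets (space M) {?h -` A \<inter> space M | A. A \<in> sets (PiM {Suc i} (\<lambda>_. borel))})"
    unfolding indep_var_eq by blast
  have "(\<lambda>x. x (Suc i)) -` B \<inter> space (PiM {Suc i} (\<lambda>_. borel)) \<in> sets (PiM {Suc i} (\<lambda>_. borel :: real measure))"
    using B by (intro measurable_sets[of _ _ borel]) auto
  moreover have "X (Suc i) -` B \<inter> space M
      = ?h -` ((\<lambda>x. x (Suc i)) -` B \<inter> space (PiM {Suc i} (\<lambda>_. borel))) \<inter> space M"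
    by (auto simp: space_PiM)
  ultimately show ?thesis
    using A unfolding sets_F by (intro indep_setD[OF ind] sigma_sets.Basic) blast+
qed

text \<open>The identity, read as a map into \<open>F i\<close>, carries the whole past, so
  independence becomes a product of measures and Fubini's theorem can replace conditional
  expectations.\<close>

lemma distr_next: "distr M (F i) (\<lambda>\<omega>. \<omega>) \<Otimes>\<^sub>M unif01 = distr M (F i \<Otimes>\<^sub>M borel) (\<lambda>\<omega>. (\<omega>, X (Suc i) \<omega>))"
proof (rule pair_measure_eqI)
  interpret U: prob_space unif01 by (rule prob_space_unif01)
  interpret D: prob_space "distr M (F i) (\<lambda>\<omega>. \<omega>)" by (rule prob_space_distr) simp
  show "sigma_finite_measure (distr M (F i) (\<lambda>\<omega>. \<omega>))" "sigma_finite_measure unif01"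
    by unfold_locales
  show "sets (distr M (F i) (\<lambda>\<omega>. \<omega>) \<Otimes>\<^sub>M unif01) = sets (distr M (F i \<Otimes>\<^sub>M borel) (\<lambda>\<omega>. (\<omega>, X (Suc i) \<omega>)))"
    by (simp cong: sets_pair_measure_cong)
  fix A B assume A: "A \<in> sets (distr M (F i) (\<lambda>\<omega>. \<omega>))" and B: "B \<in> sets unif01"
  then have sets: "A \<in> sets (F i)" "B \<in> sets borel" by auto
  have "A \<subseteq> space M" using sets.sets_into_space[OF sets(1)] by simp
  have "emeasure unif01 B = emeasure M (X (Suc i) -` B \<inter> space M)"
    using sets emeasure_distr[of "X (Suc i)" M borel B] by (simp add: distr_X)
  moreover have "emeasure (distr M (F i) (\<lambda>\<omega>. \<omega>)) A = emeasure M A"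
    using sets \<open>A \<subseteq> space M\<close> by (subst emeasure_distr) (auto simp: Int_absorb2)
  moreover have "emeasure (distr M (F i \<Otimes>\<^sub>M borel) (\<lambda>\<omega>. (\<omega>, X (Suc i) \<omega>))) (A \<times> B)
      = emeasure M (A \<inter> (X (Suc i) -` B \<inter> space M))"
    using sets \<open>A \<subseteq> space M\<close>
    by (subst emeasure_distr) (auto intro!: arg_cong[where f = "emeasure M"])
  moreover have "emeasure M (A \<inter> (X (Suc i) -` B \<inter> space M)) = emeasure M A * emeasure M (X (Suc i) -` B \<inter> space M)"
    using indep_next[OF sets] by (simp add: emeasure_eq_measure ennreal_mult)
  ultimately show "emeasure (distr M (F i) (\<lambda>\<omega>. \<omega>)) A * emeasure unif01 B
      = emeasure (distr M (F i \<Otimes>\<^sub>M borel) (\<lambda>\<omega>. (\<omega>, X (Suc i) \<omega>))) (A \<times> B)"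
    by simp
qed

text \<open>The two orders of Fubini's theorem. Averaging the next observation for a fixed past
  gives the Bellman step; averaging the past for a fixed next value gives the recursion for the law
  of the running maximum.\<close>

lemma
  fixes G :: "'a \<Rightarrow> real \<Rightarrow> real"
  assumes G [measurable]: "case_prod G \<in> borel_measurable (F i \<Otimes>\<^sub>M borel)"
    and B: "AE \<omega> in M. \<bar>G \<omega> (X (Suc i) \<omega>)\<bar> \<le> B"
  shows expectation_next: "expectation (\<lambda>\<omega>. G \<omega> (X (Suc i) \<omega>)) = expectation (\<lambda>\<omega>. \<integral>x. G \<omega> x \<partial>unif01)"
    and expectation_next': "expectation (\<lambda>\<omega>. G \<omega> (X (Suc i) \<omega>)) = (\<integral>x. expectation (\<lambda>\<omega>. G \<omega> x) \<partial>unif01)"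
proof -
  let ?D = "distr M (F i) (\<lambda>\<omega>. \<omega>)"
  interpret U: prob_space unif01 by (rule prob_space_unif01)
  interpret D: prob_space ?D by (rule prob_space_distr) simp
  interpret P: pair_prob_space ?D unif01 ..
  have [measurable]: "case_prod G \<in> borel_measurable (?D \<Otimes>\<^sub>M unif01)"
    using G by (simp add: measurable_def space_pair_measure cong: sets_pair_measure_cong)
  have pair [measurable]: "(\<lambda>\<omega>. (\<omega>, X (Suc i) \<omega>)) \<in> measurable M (F i \<Otimes>\<^sub>M borel)"
    by measurable
  have "integrable M (\<lambda>\<omega>. case_prod G (\<omega>, X (Suc i) \<omega>))"
    by (intro integrable_const_bound[where B = B] measurable_compose[OF pair G]) (use B in auto)
  then have int: "integrable (?D \<Otimes>\<^sub>M unif01) (case_prod G)"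
    unfolding distr_next by (subst integrable_distr_eq) auto
  have "expectation (\<lambda>\<omega>. G \<omega> (X (Suc i) \<omega>)) = (\<integral>p. case_prod G p \<partial>(?D \<Otimes>\<^sub>M unif01))"
    unfolding distr_next by (subst integral_distr) auto
  note eq = this
  have "(\<integral>p. case_prod G p \<partial>(?D \<Otimes>\<^sub>M unif01)) = (\<integral>\<omega>. (\<integral>x. G \<omega> x \<partial>unif01) \<partial>?D)"
    using P.integral_fst'[OF int] by simp
  also have "\<dots> = expectation (\<lambda>\<omega>. \<integral>x. G \<omega> x \<partial>unif01)"
    by (rule integral_distr) auto
  finally show "expectation (\<lambda>\<omega>. G \<omega> (X (Suc i) \<omega>)) = expectation (\<lambda>\<omega>. \<integral>x. G \<omega> x \<partial>unif01)"
    using eq by simp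
  have "(\<integral>p. case_prod G p \<partial>(?D \<Otimes>\<^sub>M unif01)) = (\<integral>x. (\<integral>\<omega>. G \<omega> x \<partial>?D) \<partial>unif01)"
    using P.integral_snd[OF int] by simp
  also have "(\<lambda>x. \<integral>\<omega>. G \<omega> x \<partial>?D) = (\<lambda>x. expectation (\<lambda>\<omega>. G \<omega> x))"
    by (intro ext integral_distr) auto
  finally show "expectation (\<lambda>\<omega>. G \<omega> (X (Suc i) \<omega>)) = (\<integral>x. expectation (\<lambda>\<omega>. G \<omega> x) \<partial>unif01)"
    using eq by simp
qed

text \<open>Off this null set no observation equals a threshold, where both decisions can be
  optimal, and none equals 1, where continuing would be worthless.\<close>

lemma AE_sample:
  "AE \<omega> in M. \<forall>i\<ge>1. 0 \<le> X i \<omega> \<and> X i \<omega> < 1 \<and> (\<forall>k. X i \<omega> \<noteq> decision_number k)"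
proof -
  have "AE \<omega> in M. 0 \<le> X i \<omega> \<and> X i \<omega> < 1 \<and> X i \<omega> \<notin> range decision_number" if i: "i \<in> {1..}" for i
  proof -
    have "AE x in lborel. x \<notin> insert 1 (range decision_number)"
      by (intro AE_not_in countable_imp_null_set_lborel) auto
    then have "AE x in lborel. x \<in> {0..1} \<longrightarrow> 0 \<le> x \<and> x < 1 \<and> x \<notin> range decision_number"
      by eventually_elim auto
    then have "AE x in unif01. 0 \<le> x \<and> x < 1 \<and> x \<notin> range decision_number"
      by (rule AE_unif01I)
    then have "AE x in distr M borel (X i). 0 \<le> x \<and> x < 1 \<and> x \<notin> range decision_number"
      using i by (subst distr_X) auto
    then show ?thesis using i by (intro AE_distrD[of "X i" M borel]) auto
  qed
  then have "AE \<omega> in M. \<forall>i\<in>{1..}. 0 \<le> X i \<omega> \<and> X i \<omega> < 1 \<and> X i \<omega> \<notin> range decision_number"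
    by (subst AE_ball_countable) auto
  then show ?thesis by eventually_elim auto
qed

lemma AE_mx: "AE \<omega> in M. \<forall>i. mx i \<omega> < 1"
  using AE_sample by eventually_elim (auto intro!: running_max_less)

section \<open>Winning probability of an accepted observation\<close>

definition reward :: "nat \<Rightarrow> nat \<Rightarrow> 'a \<Rightarrow> real" where
  "reward n i \<omega> = (if mx (i - 1) \<omega> \<le> X i \<omega> then X i \<omega> ^ (n - i) else 0)"

lemma measurable_reward [measurable (raw)]:
  assumes "1 \<le> i" "i \<le> j"
  shows "reward n i \<in> borel_measurable (F j)"
proof -
  have [measurable]: "X i \<in> borel_measurable (F j)" "mx (i - 1) \<in> borel_measurable (F j)"
    using assms by (auto intro!: measurable_F_X measurable_F_mx)
  show ?thesis unfolding reward_def by measurable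
qed

text \<open>The last observation is integrated out first: it stays below \<open>X i\<close> with
  probability \<open>X i\<close> and so raises the exponent r by one, which is why r is general in
  the induction. In the end only the record condition at time i is left.\<close>

lemma expectation_max_remaining:
  assumes i: "1 \<le> i" and A: "A \<in> sets (F i)"
  shows "expectation (\<lambda>\<omega>. indicator A \<omega> * (if X i \<omega> = mx (i + l) \<omega> then X i \<omega> ^ r else 0))
    = expectation (\<lambda>\<omega>. indicator A \<omega> * (if mx (i - 1) \<omega> \<le> X i \<omega> then X i \<omega> ^ (r + l) else 0))"
proof (induction l arbitrary: r)
  case 0
  have "X i \<omega> = mx i \<omega> \<longleftrightarrow> mx (i - 1) \<omega> \<le> X i \<omega>" for \<omega>
    using i by (cases i) auto
  then show ?case unfolding add_0_right by simp
next
  case (Suc l)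
  define G where "G \<omega> x = indicator A \<omega> * (if X i \<omega> = mx (i + l) \<omega> then X i \<omega> ^ r else 0) * (if x \<le> X i \<omega> then 1 else 0)"
    for \<omega> and x :: real
  have [measurable]: "X i \<in> borel_measurable (F (i + l))" "mx (i + l) \<in> borel_measurable (F (i + l))"
    using i by (auto intro!: measurable_F_X measurable_F_mx)
  have [measurable]: "A \<in> sets (F (i + l))" by (rule sets_F_mono[OF A]) simp
  have [measurable]: "case_prod G \<in> borel_measurable (F (i + l) \<Otimes>\<^sub>M borel)"
    unfolding G_def by measurable
  have le: "X i \<omega> \<le> mx (i + l) \<omega>" for \<omega> using i by (intro le_running_max) auto
  have "indicator A \<omega> * (if X i \<omega> = mx (i + Suc l) \<omega> then X i \<omega> ^ r else 0) = G \<omega> (X (Suc (i + l)) \<omega>)" for \<omega>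
    using le[of \<omega>] by (auto simp: G_def max_def)
  then have "expectation (\<lambda>\<omega>. indicator A \<omega> * (if X i \<omega> = mx (i + Suc l) \<omega> then X i \<omega> ^ r else 0))
      = expectation (\<lambda>\<omega>. G \<omega> (X (Suc (i + l)) \<omega>))" by simp
  also have "\<dots> = expectation (\<lambda>\<omega>. \<integral>x. G \<omega> x \<partial>unif01)"
  proof (rule expectation_next[where B = 1])
    show "AE \<omega> in M. \<bar>G \<omega> (X (Suc (i + l)) \<omega>)\<bar> \<le> 1"
      using AE_sample by eventually_elim (use i in \<open>auto simp: G_def indicator_def power_le_one less_imp_le\<close>)
  qed measurable
  also have "\<dots> = expectation (\<lambda>\<omega>. indicator A \<omega> * (if X i \<omega> = mx (i + l) \<omega> then X i \<omega> ^ Suc r else 0))"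
  proof (rule integral_cong_AE)
    show "AE \<omega> in M. (\<integral>x. G \<omega> x \<partial>unif01) = indicator A \<omega> * (if X i \<omega> = mx (i + l) \<omega> then X i \<omega> ^ Suc r else 0)"
      using AE_sample
    proof eventually_elim
      case (elim \<omega>)
      have x: "0 \<le> X i \<omega>" "X i \<omega> \<le> 1" using elim i by (auto simp: less_imp_le)
      have "(\<integral>x. (if x \<le> X i \<omega> then 1 else 0) \<partial>unif01) = (\<integral>x. indicator {0..X i \<omega>} x * x ^ 0 \<partial>unif01)"
      proof (rule integral_cong_AE)
        show "AE x in unif01. (if x \<le> X i \<omega> then 1 else 0) = indicator {0..X i \<omega>} x * x ^ 0"
          using AE_unif01 by eventually_elim (auto simp: indicator_def)
      qed measurable
      also have "\<dots> = X i \<omega>" using x by (simp only: integral_unif01_power) simp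
      finally show ?case unfolding G_def by simp
    qed
    show "(\<lambda>\<omega>. \<integral>x. G \<omega> x \<partial>unif01) \<in> borel_measurable M"
    proof -
      interpret U: prob_space unif01 by (rule prob_space_unif01)
      have "(\<lambda>\<omega>. \<integral>x. G \<omega> x \<partial>unif01) \<in> borel_measurable (F (i + l))" by measurable
      then show ?thesis by (rule measurable_from_F)
    qed
    show "(\<lambda>\<omega>. indicator A \<omega> * (if X i \<omega> = mx (i + l) \<omega> then X i \<omega> ^ Suc r else 0)) \<in> borel_measurable M"
      by (rule measurable_from_F[of _ "i + l"]) measurable
  qed
  also have "\<dots> = expectation (\<lambda>\<omega>. indicator A \<omega> * (if mx (i - 1) \<omega> \<le> X i \<omega> then X i \<omega> ^ (Suc r + l) else 0))"
    by (rule Suc.IH)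
  finally show ?case by (simp only: add_Suc_shift)
qed

text \<open>Thus \<open>reward n i\<close> acts as the conditional probability, given the first i
  observations, that the last of them is the overall maximum.\<close>

lemma prob_overall_max:
  assumes i: "1 \<le> i" "i \<le> n" and A: "A \<in> sets (F i)"
  shows "prob {\<omega> \<in> A. X i \<omega> = mx n \<omega>} = expectation (\<lambda>\<omega>. indicator A \<omega> * reward n i \<omega>)"
proof -
  have [measurable]: "X i \<in> borel_measurable M" "mx n \<in> borel_measurable M"
    using i measurable_F_mx[of n n] by (auto intro: measurable_from_F)
  have AM [measurable]: "A \<in> sets M"
    by (rule sets_F_sets_M[OF A])
  have [measurable]: "{\<omega> \<in> A. X i \<omega> = mx n \<omega>} \<in> sets M"
  proof -
    have "{\<omega> \<in> A. X i \<omega> = mx n \<omega>} = A \<inter> {\<omega> \<in> space M. X i \<omega> = mx n \<omega>}"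
      using sets.sets_into_space[OF AM] by auto
    then show ?thesis by simp
  qed
  have "prob {\<omega> \<in> A. X i \<omega> = mx n \<omega>} = expectation (indicator {\<omega> \<in> A. X i \<omega> = mx n \<omega>})"
    by simp
  also have "\<dots> = expectation (\<lambda>\<omega>. indicator A \<omega> * (if X i \<omega> = mx (i + (n - i)) \<omega> then X i \<omega> ^ 0 else 0))"
    using i by (intro Bochner_Integration.integral_cong) (auto simp: indicator_def)
  also have "\<dots> = expectation (\<lambda>\<omega>. indicator A \<omega> * reward n i \<omega>)"
    unfolding expectation_max_remaining[OF i(1) A] reward_def add_0 ..
  finally show ?thesis .
qed

lemma stopping_rule_range:
  "stopping_rule M X n \<sigma> \<Longrightarrow> \<omega> \<in> space M \<Longrightarrow> 1 \<le> \<sigma> \<omega> \<and> \<sigma> \<omega> \<le> n"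
  by (auto simp: stopping_rule_def)

lemma stopping_rule_sets:
  assumes "stopping_rule M X n \<sigma>"
  shows "{\<omega> \<in> space M. i < \<sigma> \<omega>} \<in> sets (F i)"
    and "1 \<le> i \<Longrightarrow> {\<omega> \<in> space M. \<sigma> \<omega> = i} \<in> sets (F i)"
proof -
  have le: "{\<omega> \<in> space M. \<sigma> \<omega> \<le> j} \<in> sets (F j)" for j
    using assms by (auto simp: stopping_rule_def stopping_time_def pred_def)
  have "{\<omega> \<in> space M. i < \<sigma> \<omega>} = space (F i) - {\<omega> \<in> space M. \<sigma> \<omega> \<le> i}" by auto
  then show "{\<omega> \<in> space M. i < \<sigma> \<omega>} \<in> sets (F i)" using sets.compl_sets[OF le[of i]] by simp
  show "{\<omega> \<in> space M. \<sigma> \<omega> = i} \<in> sets (F i)" if "1 \<le> i"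
  proof -
    have "{\<omega> \<in> space M. \<sigma> \<omega> \<le> i - 1} \<in> sets (F i)"
      by (rule sets_F_mono[OF le]) simp
    moreover have "{\<omega> \<in> space M. \<sigma> \<omega> = i} = {\<omega> \<in> space M. \<sigma> \<omega> \<le> i} - {\<omega> \<in> space M. \<sigma> \<omega> \<le> i - 1}"
      using that by auto
    ultimately show ?thesis using sets.Diff[OF le[of i]] by simp
  qed
qed

lemma AE_Max_eq:
  "AE \<omega> in M. \<forall>n\<ge>1. Max ((\<lambda>j. X j \<omega>) ` {1..n}) = mx n \<omega>"
  using AE_sample
proof eventually_elim
  case (elim \<omega>)
  then show ?case by (intro allI impI running_max_eq_Max) auto
qed

lemma measurable_Max: "(\<lambda>\<omega>. Max ((\<lambda>j. X j \<omega>) ` {1..n})) \<in> borel_measurable M"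
  by (intro borel_measurable_Max) auto

lemma success_prob_eq:
  assumes \<sigma>: "stopping_rule M X n \<sigma>" and n: "1 \<le> n"
  shows "success_prob M X n \<sigma> = (\<Sum>i=1..n. expectation (\<lambda>\<omega>. indicator {\<omega> \<in> space M. \<sigma> \<omega> = i} \<omega> * reward n i \<omega>))"
proof -
  have meas: "{\<omega> \<in> space M. \<sigma> \<omega> = i \<and> X i \<omega> = mx n \<omega>} \<in> sets M"
    "{\<omega> \<in> space M. \<sigma> \<omega> = i \<and> X i \<omega> = Max ((\<lambda>j. X j \<omega>) ` {1..n})} \<in> sets M" if "i \<in> {1..n}" for i
  proof -
    have [measurable]: "X i \<in> borel_measurable M" "mx n \<in> borel_measurable M"
      "(\<lambda>\<omega>. Max ((\<lambda>j. X j \<omega>) ` {1..n})) \<in> borel_measurable M"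
      using that measurable_F_mx[of n n] by (auto intro: measurable_from_F measurable_Max)
    have [measurable]: "{\<omega> \<in> space M. \<sigma> \<omega> = i} \<in> sets M"
      using stopping_rule_sets(2)[OF \<sigma>, of i] that by (auto intro: sets_F_sets_M)
    have "{\<omega> \<in> space M. \<sigma> \<omega> = i} \<inter> {\<omega> \<in> space M. X i \<omega> = mx n \<omega>} \<in> sets M"
      "{\<omega> \<in> space M. \<sigma> \<omega> = i} \<inter> {\<omega> \<in> space M. X i \<omega> = Max ((\<lambda>j. X j \<omega>) ` {1..n})} \<in> sets M"
      by measurable
    then show "{\<omega> \<in> space M. \<sigma> \<omega> = i \<and> X i \<omega> = mx n \<omega>} \<in> sets M"
      "{\<omega> \<in> space M. \<sigma> \<omega> = i \<and> X i \<omega> = Max ((\<lambda>j. X j \<omega>) ` {1..n})} \<in> sets M"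
      by (simp_all add: Int_def conj_ac cong: conj_cong)
  qed
  have "{\<omega> \<in> space M. X (\<sigma> \<omega>) \<omega> = Max ((\<lambda>j. X j \<omega>) ` {1..n})}
      = (\<Union>i\<in>{1..n}. {\<omega> \<in> space M. \<sigma> \<omega> = i \<and> X i \<omega> = Max ((\<lambda>j. X j \<omega>) ` {1..n})})"
    using stopping_rule_range[OF \<sigma>] by auto
  then have "success_prob M X n \<sigma>
      = (\<Sum>i=1..n. prob {\<omega> \<in> space M. \<sigma> \<omega> = i \<and> X i \<omega> = Max ((\<lambda>j. X j \<omega>) ` {1..n})})"
    unfolding success_prob_def using meas(2)
    by (simp only:) (intro finite_measure_finite_Union, auto simp: disjoint_family_on_def)
  also have "\<dots> = (\<Sum>i=1..n. expectation (\<lambda>\<omega>. indicator {\<omega> \<in> space M. \<sigma> \<omega> = i} \<omega> * reward n i \<omega>))"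
  proof (rule sum.cong)
    fix i assume i: "i \<in> {1..n}"
    have "prob {\<omega> \<in> space M. \<sigma> \<omega> = i \<and> X i \<omega> = Max ((\<lambda>j. X j \<omega>) ` {1..n})}
        = prob {\<omega> \<in> space M. \<sigma> \<omega> = i \<and> X i \<omega> = mx n \<omega>}"
    proof (rule finite_measure_eq_AE)
      show "AE \<omega> in M. (\<omega> \<in> {\<omega> \<in> space M. \<sigma> \<omega> = i \<and> X i \<omega> = Max ((\<lambda>j. X j \<omega>) ` {1..n})})
          = (\<omega> \<in> {\<omega> \<in> space M. \<sigma> \<omega> = i \<and> X i \<omega> = mx n \<omega>})"
        using AE_Max_eq by eventually_elim (use n in auto)
    qed (use meas[OF i] in auto)
    also have "{\<omega> \<in> space M. \<sigma> \<omega> = i \<and> X i \<omega> = mx n \<omega>} = {\<omega> \<in> {\<omega> \<in> space M. \<sigma> \<omega> = i}. X i \<omega> = mx n \<omega>}"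
      by auto
    also have "prob \<dots> = expectation (\<lambda>\<omega>. indicator {\<omega> \<in> space M. \<sigma> \<omega> = i} \<omega> * reward n i \<omega>)"
      using i by (intro prob_overall_max stopping_rule_sets(2)[OF \<sigma>]) auto
    finally show "prob {\<omega> \<in> space M. \<sigma> \<omega> = i \<and> X i \<omega> = Max ((\<lambda>j. X j \<omega>) ` {1..n})}
        = expectation (\<lambda>\<omega>. indicator {\<omega> \<in> space M. \<sigma> \<omega> = i} \<omega> * reward n i \<omega>)" .
  qed simp
  finally show ?thesis .
qed

text \<open>The loss from the decision at time \<open>i + 1\<close>, compared with continuing optimally from time \<open>i\<close>.\<close>

definition loss :: "nat \<Rightarrow> ('a \<Rightarrow> nat) \<Rightarrow> nat \<Rightarrow> 'a \<Rightarrow> real" where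
  "loss n \<sigma> i \<omega> = (if i < \<sigma> \<omega> then stage_value (n - Suc i) (mx i \<omega>) (X (Suc i) \<omega>)
     - (if \<sigma> \<omega> = Suc i then reward n (Suc i) \<omega> else continuation_value (n - Suc i) (mx (Suc i) \<omega>)) else 0)"

lemma AE_loss:
  "AE \<omega> in M. \<forall>\<sigma> i. 0 \<le> loss n \<sigma> i \<omega> \<and> loss n \<sigma> i \<omega> \<le> 1"
  using AE_sample
proof eventually_elim
  case (elim \<omega>)
  have x: "0 \<le> X (Suc i) \<omega>" "X (Suc i) \<omega> \<le> 1" for i using elim by (auto simp: less_imp_le)
  then have "stage_value (n - Suc i) (mx i \<omega>) (X (Suc i) \<omega>) \<le> 1" for i
    by (intro stage_value_bounds)
  moreover have "0 \<le> reward n (Suc i) \<omega>" for i using x by (simp add: reward_def)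
  moreover have "reward n (Suc i) \<omega> \<le> stage_value (n - Suc i) (mx i \<omega>) (X (Suc i) \<omega>)" for i
    by (auto simp: reward_def stage_value_def)
  moreover have "continuation_value (n - Suc i) (mx (Suc i) \<omega>) \<le> stage_value (n - Suc i) (mx i \<omega>) (X (Suc i) \<omega>)" for i
    by (auto simp: stage_value_def max_def)
  ultimately show ?case unfolding loss_def
    using continuation_value_nonneg by (smt (verit, best))
qed

text \<open>The event i < \<sigma> is decided by the first i observations, so on it the stage value
  may be averaged over the next observation, which gives the continuation value at time i.\<close>

lemma
  assumes \<sigma>: "stopping_rule M X n \<sigma>" and i: "i < n"
  shows integrable_loss: "integrable M (loss n \<sigma> i)"
    and expectation_loss: "expectation (loss n \<sigma> i)
      = expectation (\<lambda>\<omega>. indicator {\<omega> \<in> space M. i < \<sigma> \<omega>} \<omega> * continuation_value (n - i) (mx i \<omega>))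
      - expectation (\<lambda>\<omega>. indicator {\<omega> \<in> space M. \<sigma> \<omega> = Suc i} \<omega> * reward n (Suc i) \<omega>)
      - expectation (\<lambda>\<omega>. indicator {\<omega> \<in> space M. Suc i < \<sigma> \<omega>} \<omega> * continuation_value (n - Suc i) (mx (Suc i) \<omega>))"
proof -
  let ?A = "{\<omega> \<in> space M. i < \<sigma> \<omega>}" and ?B = "{\<omega> \<in> space M. \<sigma> \<omega> = Suc i}" and ?C = "{\<omega> \<in> space M. Suc i < \<sigma> \<omega>}"
  have AF [measurable]: "?A \<in> sets (F i)" and BF: "?B \<in> sets (F (Suc i))" and CF: "?C \<in> sets (F (Suc i))"
    using stopping_rule_sets[OF \<sigma>] by auto
  have [measurable]: "?A \<in> sets M" "?B \<in> sets M" "?C \<in> sets M"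
    by (rule sets_F_sets_M[OF AF] sets_F_sets_M[OF BF] sets_F_sets_M[OF CF])+
  have [measurable]: "mx i \<in> borel_measurable (F i)" by (rule measurable_F_mx) simp
  have [measurable]: "mx i \<in> borel_measurable M" "mx (Suc i) \<in> borel_measurable M" "reward n (Suc i) \<in> borel_measurable M"
    "X (Suc i) \<in> borel_measurable M"
    by (rule measurable_from_F[OF measurable_F_mx[OF order_refl]] measurable_from_F[OF measurable_reward[OF _ order_refl]]
        measurable_X; simp)+
  let ?a = "\<lambda>\<omega>. indicator ?A \<omega> * stage_value (n - Suc i) (mx i \<omega>) (X (Suc i) \<omega>)"
  let ?b = "\<lambda>\<omega>. indicator ?B \<omega> * reward n (Suc i) \<omega>"
  let ?c = "\<lambda>\<omega>. indicator ?C \<omega> * continuation_value (n - Suc i) (mx (Suc i) \<omega>)"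
  have aeb: "AE \<omega> in M. norm (?a \<omega>) \<le> 1 \<and> norm (?b \<omega>) \<le> 1 \<and> norm (?c \<omega>) \<le> 1"
    using AE_sample
  proof eventually_elim
    case (elim \<omega>)
    then have x: "0 \<le> X (Suc i) \<omega>" "X (Suc i) \<omega> \<le> 1" by (auto simp: less_imp_le)
    then show ?case
      using stage_value_bounds[OF x]
      by (auto simp: indicator_def reward_def power_le_one)
  qed
  have int: "integrable M ?a" "integrable M ?b" "integrable M ?c"
    by (rule integrable_const_bound[where B = 1], use aeb in eventually_elim, simp, measurable)+
  have eq: "loss n \<sigma> i \<omega> = ?a \<omega> - ?b \<omega> - ?c \<omega>" if "\<omega> \<in> space M" for \<omega>
    using that by (auto simp: loss_def indicator_def)
  show "integrable M (loss n \<sigma> i)"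
    using int by (subst Bochner_Integration.integrable_cong[OF refl eq]) auto
  have "expectation (loss n \<sigma> i) = expectation (\<lambda>\<omega>. ?a \<omega> - ?b \<omega> - ?c \<omega>)"
    by (rule Bochner_Integration.integral_cong[OF refl eq])
  also have "\<dots> = expectation ?a - expectation ?b - expectation ?c"
    using int by simp
  also have "expectation ?a = expectation (\<lambda>\<omega>. \<integral>x. indicator ?A \<omega> * stage_value (n - Suc i) (mx i \<omega>) x \<partial>unif01)"
  proof (rule expectation_next[where B = 1])
    show "AE \<omega> in M. \<bar>?a \<omega>\<bar> \<le> 1" using aeb by eventually_elim auto
  qed measurable
  also have "\<dots> = expectation (\<lambda>\<omega>. indicator ?A \<omega> * continuation_value (n - i) (mx i \<omega>))"
    using i by (simp flip: continuation_value_Suc add: Suc_diff_Suc)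
  finally show "expectation (loss n \<sigma> i)
      = expectation (\<lambda>\<omega>. indicator ?A \<omega> * continuation_value (n - i) (mx i \<omega>))
      - expectation ?b - expectation ?c" .
qed

text \<open>The continuation terms telescope from \<open>continuation_value n 0\<close> down to 0,
  since nothing is left after time n, and the stopping terms add up to the success
  probability.\<close>

lemma sum_expectation_loss:
  assumes \<sigma>: "stopping_rule M X n \<sigma>" and n: "1 \<le> n"
  shows "(\<Sum>i<n. expectation (loss n \<sigma> i)) = continuation_value n 0 - success_prob M X n \<sigma>"
proof -
  define g where "g i = expectation (\<lambda>\<omega>. indicator {\<omega> \<in> space M. i < \<sigma> \<omega>} \<omega> * continuation_value (n - i) (mx i \<omega>))" for i
  define h where "h i = expectation (\<lambda>\<omega>. indicator {\<omega> \<in> space M. \<sigma> \<omega> = i} \<omega> * reward n i \<omega>)" for i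
  have "g 0 = expectation (\<lambda>\<omega>. continuation_value n 0)"
    unfolding g_def
  proof (rule Bochner_Integration.integral_cong[OF refl])
    fix \<omega> assume "\<omega> \<in> space M"
    then show "indicator {\<omega> \<in> space M. 0 < \<sigma> \<omega>} \<omega> * continuation_value (n - 0) (mx 0 \<omega>) = continuation_value n 0"
      using stopping_rule_range[OF \<sigma>, of \<omega>] by (simp add: indicator_def)
  qed
  then have g0: "g 0 = continuation_value n 0" by (simp add: prob_space)
  have gn: "g n = 0" by (simp add: g_def)
  have "expectation (loss n \<sigma> i) = (g i - g (Suc i)) - h (Suc i)" if "i < n" for i
    using expectation_loss[OF \<sigma> that] unfolding g_def h_def by simp
  then have "(\<Sum>i<n. expectation (loss n \<sigma> i)) = (\<Sum>i<n. g i - g (Suc i)) - (\<Sum>i<n. h (Suc i))"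
    by (simp flip: sum_subtractf)
  also have "(\<Sum>i<n. g i - g (Suc i)) = g 0 - g n" by (rule sum_lessThan_telescope')
  also have "(\<Sum>i<n. h (Suc i)) = (\<Sum>i=1..n. h i)"
    by (rule sum.reindex_bij_witness[of _ "\<lambda>i. i - 1" Suc]) auto
  finally show ?thesis unfolding success_prob_eq[OF \<sigma> n] h_def[symmetric] g0 gn by simp
qed

section \<open>The threshold rule and the form of every optimal rule\<close>

definition stop :: "nat \<Rightarrow> nat \<Rightarrow> 'a \<Rightarrow> bool" where
  "stop n i \<omega> \<longleftrightarrow> mx (i - 1) \<omega> \<le> X i \<omega> \<and> decision_number (n - i) \<le> X i \<omega>"

definition no_stop :: "nat \<Rightarrow> nat \<Rightarrow> 'a \<Rightarrow> bool" where
  "no_stop n i \<omega> \<longleftrightarrow> (\<forall>j\<in>{1..i}. \<not> stop n j \<omega>)"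

definition threshold_rule :: "nat \<Rightarrow> 'a \<Rightarrow> nat" where
  "threshold_rule n \<omega> = (LEAST i. 1 \<le> i \<and> (i = n \<or> stop n i \<omega>))"

lemma pred_stop:
  assumes "1 \<le> i" "i \<le> j"
  shows "Measurable.pred (F j) (stop n i)"
proof -
  have [measurable]: "X i \<in> borel_measurable (F j)" "mx (i - 1) \<in> borel_measurable (F j)"
    using assms by (auto intro!: measurable_F_X measurable_F_mx)
  show ?thesis unfolding stop_def by measurable
qed

lemma pred_no_stop: "i \<le> j \<Longrightarrow> Measurable.pred (F j) (no_stop n i)"
  unfolding no_stop_def by (intro pred_intros_finite pred_intros_logic pred_stop) auto

lemma threshold_rule:
  assumes "1 \<le> n"
  shows "1 \<le> threshold_rule n \<omega>" "threshold_rule n \<omega> = n \<or> stop n (threshold_rule n \<omega>) \<omega>"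
  using LeastI[of "\<lambda>i. 1 \<le> i \<and> (i = n \<or> stop n i \<omega>)" n] assms
  by (auto simp: threshold_rule_def)

lemma threshold_rule_le:
  "1 \<le> i \<Longrightarrow> i = n \<or> stop n i \<omega> \<Longrightarrow> threshold_rule n \<omega> \<le> i"
  unfolding threshold_rule_def by (intro Least_le) auto

lemma threshold_rule_le_iff:
  assumes "1 \<le> n"
  shows "threshold_rule n \<omega> \<le> i \<longleftrightarrow> n \<le> i \<or> (\<exists>j\<in>{1..i}. stop n j \<omega>)"
proof
  assume "threshold_rule n \<omega> \<le> i"
  then show "n \<le> i \<or> (\<exists>j\<in>{1..i}. stop n j \<omega>)"
    using threshold_rule[OF assms, of \<omega>] by (metis atLeastAtMost_iff)
next
  assume "n \<le> i \<or> (\<exists>j\<in>{1..i}. stop n j \<omega>)"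
  then show "threshold_rule n \<omega> \<le> i"
    using threshold_rule_le[of n n \<omega>] threshold_rule_le[of _ n \<omega>] assms
    by (metis atLeastAtMost_iff le_trans)
qed

lemma stopping_rule_threshold:
  assumes "1 \<le> n"
  shows "stopping_rule M X n (threshold_rule n)"
  unfolding stopping_rule_def stopping_time_def
proof (intro conjI allI ballI)
  show "Measurable.pred (F i) (\<lambda>\<omega>. threshold_rule n \<omega> \<le> i)" for i
    unfolding threshold_rule_le_iff[OF assms]
    by (intro pred_intros_finite pred_intros_logic pred_stop) auto
  show "threshold_rule n \<omega> \<in> {1..n}" for \<omega>
    using threshold_rule(1)[OF assms] threshold_rule_le[of n n \<omega>] assms by simp
qed

lemma success_prob_threshold:
  assumes n: "1 \<le> n"
  shows "success_prob M X n (threshold_rule n) = continuation_value n 0"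
proof -
  let ?\<sigma> = "threshold_rule n"
  note \<sigma> = stopping_rule_threshold[OF n]
  have zero: "AE \<omega> in M. loss n ?\<sigma> i \<omega> = 0" if i: "i < n" for i
    using AE_sample
  proof eventually_elim
    case (elim \<omega>)
    then have x: "0 \<le> X (Suc i) \<omega>" "X (Suc i) \<omega> \<le> 1" by (auto simp: less_imp_le)
    show ?case
    proof (cases "?\<sigma> \<omega> = Suc i")
      case True
      \<comment> \<open>Being forced to stop at time n loses nothing even without a record, as
        \<open>continuation_value 0\<close> is 0.\<close>
      then have "Suc i = n \<or> stop n (Suc i) \<omega>" using threshold_rule(2)[OF n, of \<omega>] by simp
      then show ?thesis
        using True x continuation_value_le_power[of "n - Suc i" "X (Suc i) \<omega>"]
        by (auto simp: loss_def stage_value_def reward_def stop_def max_def)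
    next
      case False
      show ?thesis
      proof (cases "i < ?\<sigma> \<omega>")
        case True
        then have "\<not> stop n (Suc i) \<omega>" using threshold_rule_le[of "Suc i" n \<omega>] False by auto
        then show ?thesis
          using False True x continuation_value_gt_power[of "X (Suc i) \<omega>" "n - Suc i"]
          by (auto simp: loss_def stage_value_def stop_def max_def)
      qed (simp add: loss_def)
    qed
  qed
  have "expectation (loss n ?\<sigma> i) = 0" if i: "i < n" for i
    using integral_cong_AE[OF borel_measurable_integrable[OF integrable_loss[OF \<sigma> i]] _ zero[OF i]] by simp
  then show ?thesis using sum_expectation_loss[OF \<sigma> n] by simp
qed

text \<open>Expected losses are nonnegative and, by comparison with the threshold rule, sum to at
  most 0, so each loss vanishes almost surely. The claim is limited to i < \<tau> because a loss
  arises only while the rule is still running.\<close>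

lemma optimal_decisions:
  assumes n: "1 \<le> n" and opt: "optimal_stopping_rule M X n \<tau>"
  shows "AE \<omega> in M. \<forall>i<n. i < \<tau> \<omega> \<longrightarrow> (\<tau> \<omega> = Suc i \<longleftrightarrow> Suc i = n \<or> stop n (Suc i) \<omega>)"
proof -
  have \<tau>: "stopping_rule M X n \<tau>" using opt by (simp add: optimal_stopping_rule_def)
  have "continuation_value n 0 \<le> success_prob M X n \<tau>"
    using opt stopping_rule_threshold[OF n] success_prob_threshold[OF n]
    by (auto simp: optimal_stopping_rule_def)
  then have le: "(\<Sum>i<n. expectation (loss n \<tau> i)) \<le> 0" using sum_expectation_loss[OF \<tau> n] by simp
  have ae: "AE \<omega> in M. 0 \<le> loss n \<tau> i \<omega>" for i
    using AE_loss[of n] by eventually_elim blast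
  then have nonneg: "0 \<le> expectation (loss n \<tau> i)" for i
    by (intro integral_nonneg_AE)
  then have "(\<Sum>i<n. expectation (loss n \<tau> i)) = 0" using le by (intro antisym sum_nonneg) auto
  then have "expectation (loss n \<tau> i) = 0" if "i < n" for i
    using nonneg that by (simp add: sum_nonneg_eq_0_iff)
  then have "AE \<omega> in M. loss n \<tau> i \<omega> = 0" if "i < n" for i
    using that ae by (subst integral_nonneg_eq_0_iff_AE[symmetric, OF integrable_loss[OF \<tau>]]) auto
  then have "AE \<omega> in M. \<forall>i\<in>{..<n}. loss n \<tau> i \<omega> = 0" by (subst AE_ball_countable) auto
  with AE_sample AE_mx AE_space show ?thesis
  proof eventually_elim
    case (elim \<omega>)
    show ?case
    proof (intro allI impI)
      fix i assume i: "i < n" "i < \<tau> \<omega>"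
      let ?x = "X (Suc i) \<omega>" and ?k = "n - Suc i" and ?m = "mx i \<omega>"
      have x: "0 \<le> ?x" "?x \<le> 1" "?x \<noteq> decision_number ?k" using elim by (auto simp: less_imp_le)
      have m: "0 \<le> ?m" "?m < 1" using elim running_max_nonneg by auto
      have loss: "stage_value ?k ?m ?x = (if \<tau> \<omega> = Suc i then reward n (Suc i) \<omega> else continuation_value ?k (max ?m ?x))"
      proof -
        have "loss n \<tau> i \<omega> = 0" using elim i by auto
        then show ?thesis using i by (simp add: loss_def split: if_splits)
      qed
      have last: "\<tau> \<omega> \<le> n" using stopping_rule_range[OF \<tau>] elim by auto
      show "\<tau> \<omega> = Suc i \<longleftrightarrow> Suc i = n \<or> stop n (Suc i) \<omega>"
      proof (cases "Suc i = n")
        case True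
        then show ?thesis using i last by auto
      next
        case False
        then have k: "1 \<le> ?k" using i by auto
        show ?thesis
        proof
          assume t: "\<tau> \<omega> = Suc i"
          \<comment> \<open>Accepting a non-record is worth 0, while continuing has positive value
            because the maximum is below 1 and an observation remains.\<close>
          have "?m \<le> ?x"
          proof (rule ccontr)
            assume "\<not> ?m \<le> ?x"
            then have "continuation_value ?k ?m = 0" using loss t by (simp add: stage_value_def reward_def)
            then show False using continuation_value_pos[OF m k] by simp
          qed
          then have "max (?x ^ ?k) (continuation_value ?k ?x) = ?x ^ ?k"
            using loss t by (simp add: stage_value_def reward_def)
          then have "\<not> ?x < decision_number ?k"
            using continuation_value_gt_power[OF x(1), of ?k] by (auto simp: max_def split: if_splits)
          then show "Suc i = n \<or> stop n (Suc i) \<omega>" using \<open>?m \<le> ?x\<close> by (simp add: stop_def)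
        next
          assume "Suc i = n \<or> stop n (Suc i) \<omega>"
          \<comment> \<open>Since \<open>?x\<close> differs from the threshold, accepting is
            strictly better, and passing over would leave a positive loss.\<close>
          then have s: "?m \<le> ?x" "decision_number ?k < ?x" using False x by (auto simp: stop_def)
          show "\<tau> \<omega> = Suc i"
          proof (rule ccontr)
            assume "\<tau> \<omega> \<noteq> Suc i"
            then have "max (?x ^ ?k) (continuation_value ?k ?x) = continuation_value ?k ?x"
              using loss s by (simp add: stage_value_def max_def)
            then show False using continuation_value_less_power[OF s(2) x(2)] by simp
          qed
        qed
      qed
    qed
  qed
qed

section \<open>Law of the running maximum before stopping\<close>

definition wait_prob :: "nat \<Rightarrow> nat \<Rightarrow> real \<Rightarrow> real" where
  "wait_prob n i x = prob {\<omega> \<in> space M. no_stop n i \<omega> \<and> mx i \<omega> \<le> x}"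

lemma sets_wait [measurable]: "{\<omega> \<in> space M. no_stop n i \<omega> \<and> mx i \<omega> \<le> x} \<in> sets M"
proof -
  have [measurable]: "Measurable.pred (F i) (no_stop n i)" "mx i \<in> borel_measurable (F i)"
    by (auto intro: pred_no_stop measurable_F_mx)
  have "{\<omega> \<in> space (F i). no_stop n i \<omega> \<and> mx i \<omega> \<le> x} \<in> sets (F i)" by measurable
  then show ?thesis by (auto intro: sets_F_sets_M)
qed

lemma prob_optimal_stop_eq:
  assumes opt: "optimal_stopping_rule M X n \<tau>" and i: "1 \<le> i" "i \<le> n"
  shows "prob {\<omega> \<in> space M. \<tau> \<omega> = i \<and> X i \<omega> = Max ((\<lambda>j. X j \<omega>) ` {1..n})}
    = (\<integral>u. (if decision_number (n - i) \<le> u then u ^ (n - i) * wait_prob n (i - 1) u else 0) \<partial>unif01)"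
proof -
  have n: "1 \<le> n" using i by simp
  have \<tau>: "stopping_rule M X n \<tau>" using opt by (simp add: optimal_stopping_rule_def)
  define l where "l = i - 1"
  have l: "i = Suc l" using i by (simp add: l_def)
  let ?d = "decision_number (n - i)"
  define A where "A = {\<omega> \<in> space M. no_stop n l \<omega> \<and> stop n i \<omega>}"
  have AF: "A \<in> sets (F i)"
  proof -
    have [measurable]: "Measurable.pred (F i) (no_stop n l)" "Measurable.pred (F i) (stop n i)"
      using i by (auto intro!: pred_no_stop pred_stop simp: l_def)
    have "{\<omega> \<in> space (F i). no_stop n l \<omega> \<and> stop n i \<omega>} \<in> sets (F i)" by measurable
    then show ?thesis by (simp add: A_def)
  qed
  have [measurable]: "X i \<in> borel_measurable M" "mx n \<in> borel_measurable M"
      "(\<lambda>\<omega>. Max ((\<lambda>j. X j \<omega>) ` {1..n})) \<in> borel_measurable M"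
    using i measurable_F_mx[of n n] by (auto intro: measurable_from_F measurable_Max)
  have [measurable]: "A \<in> sets M" "{\<omega> \<in> space M. \<tau> \<omega> = i} \<in> sets M"
    using AF stopping_rule_sets(2)[OF \<tau> i(1)] by (auto intro: sets_F_sets_M)
  have "{\<omega> \<in> space M. \<tau> \<omega> = i} \<inter> {\<omega> \<in> space M. X i \<omega> = Max ((\<lambda>j. X j \<omega>) ` {1..n})} \<in> sets M"
    "A \<inter> {\<omega> \<in> space M. X i \<omega> = mx n \<omega>} \<in> sets M" by measurable
  moreover have "{\<omega> \<in> space M. \<tau> \<omega> = i} \<inter> {\<omega> \<in> space M. X i \<omega> = Max ((\<lambda>j. X j \<omega>) ` {1..n})}
      = {\<omega> \<in> space M. \<tau> \<omega> = i \<and> X i \<omega> = Max ((\<lambda>j. X j \<omega>) ` {1..n})}"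
    "A \<inter> {\<omega> \<in> space M. X i \<omega> = mx n \<omega>} = {\<omega> \<in> A. X i \<omega> = mx n \<omega>}"
    by (auto simp: A_def)
  ultimately have sets: "{\<omega> \<in> space M. \<tau> \<omega> = i \<and> X i \<omega> = Max ((\<lambda>j. X j \<omega>) ` {1..n})} \<in> sets M"
    "{\<omega> \<in> A. X i \<omega> = mx n \<omega>} \<in> sets M" by auto
  have "prob {\<omega> \<in> space M. \<tau> \<omega> = i \<and> X i \<omega> = Max ((\<lambda>j. X j \<omega>) ` {1..n})} = prob {\<omega> \<in> A. X i \<omega> = mx n \<omega>}"
  proof (rule finite_measure_eq_AE)
    show "AE \<omega> in M. (\<omega> \<in> {\<omega> \<in> space M. \<tau> \<omega> = i \<and> X i \<omega> = Max ((\<lambda>j. X j \<omega>) ` {1..n})})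
        = (\<omega> \<in> {\<omega> \<in> A. X i \<omega> = mx n \<omega>})"
      using optimal_decisions[OF n opt] AE_Max_eq AE_sample AE_space
    proof eventually_elim
      case (elim \<omega>)
      have dec: "\<tau> \<omega> = j \<longleftrightarrow> j = n \<or> stop n j \<omega>" if "1 \<le> j" "j \<le> n" "j \<le> \<tau> \<omega>" for j
        using elim(1)[rule_format, of "j - 1"] that by simp
      have max: "Max ((\<lambda>j. X j \<omega>) ` {1..n}) = mx n \<omega>" using elim(2) n by blast
      show ?case
      proof (cases "X i \<omega> = mx n \<omega>")
        case eq: True
        \<comment> \<open>At time n a rule must stop whether or not \<open>stop\<close> holds; if
          the last observation is the maximum, \<open>stop\<close> does hold because
          \<open>decision_number 0\<close> is 0.\<close>
        have "mx (i - 1) \<omega> \<le> X i \<omega>" unfolding eq using i by (intro running_max_mono) auto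
        moreover have "0 \<le> X i \<omega>" using elim(3) i by auto
        ultimately have last: "stop n i \<omega>" if "i = n" using that by (simp add: stop_def)
        have "\<tau> \<omega> = i \<longleftrightarrow> no_stop n l \<omega> \<and> stop n i \<omega>"
        proof
          assume t: "\<tau> \<omega> = i"
          then have "stop n i \<omega>" using dec[of i] i last by auto
          moreover have "\<not> stop n j \<omega>" if "j \<in> {1..l}" for j
            using dec[of j] that t l i by auto
          ultimately show "no_stop n l \<omega> \<and> stop n i \<omega>" by (auto simp: no_stop_def)
        next
          assume s: "no_stop n l \<omega> \<and> stop n i \<omega>"
          have "\<not> \<tau> \<omega> < i"
          proof
            assume lt: "\<tau> \<omega> < i"
            moreover have "1 \<le> \<tau> \<omega>" using stopping_rule_range[OF \<tau> elim(4)] by simp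
            ultimately show False using dec[of "\<tau> \<omega>"] s i l by (auto simp: no_stop_def)
          qed
          then show "\<tau> \<omega> = i" using dec[of i] s i by auto
        qed
        then show ?thesis using max eq elim(4) by (auto simp: A_def)
      qed (use max in auto)
    qed
  qed (rule sets)+
  also have "\<dots> = expectation (\<lambda>\<omega>. indicator A \<omega> * reward n i \<omega>)"
    by (rule prob_overall_max[OF i AF])
  also have "\<dots> = expectation (\<lambda>\<omega>. (if no_stop n l \<omega> \<and> mx l \<omega> \<le> X (Suc l) \<omega> \<and> ?d \<le> X (Suc l) \<omega> then X (Suc l) \<omega> ^ (n - i) else 0))"
    by (intro Bochner_Integration.integral_cong) (auto simp: A_def indicator_def reward_def stop_def l)
  also have "\<dots> = (\<integral>u. expectation (\<lambda>\<omega>. (if no_stop n l \<omega> \<and> mx l \<omega> \<le> u \<and> ?d \<le> u then u ^ (n - i) else 0)) \<partial>unif01)"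
  proof (rule expectation_next'[where B = 1])
    have [measurable]: "Measurable.pred (F l) (no_stop n l)" "mx l \<in> borel_measurable (F l)"
      by (auto intro: pred_no_stop measurable_F_mx)
    show "(\<lambda>(\<omega>, u). if no_stop n l \<omega> \<and> mx l \<omega> \<le> u \<and> ?d \<le> u then u ^ (n - i) else 0) \<in> borel_measurable (F l \<Otimes>\<^sub>M borel)"
      by measurable
    show "AE \<omega> in M. \<bar>if no_stop n l \<omega> \<and> mx l \<omega> \<le> X (Suc l) \<omega> \<and> ?d \<le> X (Suc l) \<omega> then X (Suc l) \<omega> ^ (n - i) else 0\<bar> \<le> 1"
      using AE_sample by eventually_elim (auto simp: power_le_one less_imp_le)
  qed
  also have "\<dots> = (\<integral>u. (if ?d \<le> u then u ^ (n - i) * wait_prob n l u else 0) \<partial>unif01)"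
  proof (rule Bochner_Integration.integral_cong[OF refl])
    fix u
    have "expectation (\<lambda>\<omega>. (if no_stop n l \<omega> \<and> mx l \<omega> \<le> u \<and> ?d \<le> u then u ^ (n - i) else 0))
        = expectation (\<lambda>\<omega>. (if ?d \<le> u then u ^ (n - i) else 0) * indicator {\<omega> \<in> space M. no_stop n l \<omega> \<and> mx l \<omega> \<le> u} \<omega>)"
      by (intro Bochner_Integration.integral_cong) (auto simp: indicator_def)
    then show "expectation (\<lambda>\<omega>. (if no_stop n l \<omega> \<and> mx l \<omega> \<le> u \<and> ?d \<le> u then u ^ (n - i) else 0))
        = (if ?d \<le> u then u ^ (n - i) * wait_prob n l u else 0)"
      by (simp add: wait_prob_def)
  qed
  finally show ?thesis unfolding l_def .
qed

text \<open>A next observation u \<le> x leaves the bound x on the maximum intact. It ends the wait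
  when it reaches the threshold and is a record, that is, when the old maximum is at most u; this
  removes \<open>wait_prob n l u\<close>.\<close>

lemma wait_prob_Suc:
  "wait_prob n (Suc l) x = (\<integral>u. (if u \<le> x then wait_prob n l x
     - (if decision_number (n - Suc l) \<le> u then wait_prob n l u else 0) else 0) \<partial>unif01)"
proof -
  let ?d = "decision_number (n - Suc l)"
  define G :: "'a \<Rightarrow> real \<Rightarrow> real" where
    "G \<omega> u = (if u \<le> x \<and> no_stop n l \<omega> \<and> mx l \<omega> \<le> x \<and> \<not> (mx l \<omega> \<le> u \<and> ?d \<le> u) then 1 else 0)" for \<omega> u
  have no_stop_Suc: "no_stop n (Suc l) \<omega> \<longleftrightarrow> no_stop n l \<omega> \<and> \<not> stop n (Suc l) \<omega>" for \<omega>
    by (auto simp: no_stop_def atLeastAtMostSuc_conv)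
  have "wait_prob n (Suc l) x = expectation (indicator {\<omega> \<in> space M. no_stop n (Suc l) \<omega> \<and> mx (Suc l) \<omega> \<le> x})"
    by (simp add: wait_prob_def del: running_max.simps)
  also have "\<dots> = expectation (\<lambda>\<omega>. G \<omega> (X (Suc l) \<omega>))"
    by (intro Bochner_Integration.integral_cong) (auto simp: indicator_def G_def no_stop_Suc stop_def)
  also have "\<dots> = (\<integral>u. expectation (\<lambda>\<omega>. G \<omega> u) \<partial>unif01)"
  proof (rule expectation_next'[where B = 1])
    have [measurable]: "Measurable.pred (F l) (no_stop n l)" "mx l \<in> borel_measurable (F l)"
      by (auto intro: pred_no_stop measurable_F_mx)
    show "case_prod G \<in> borel_measurable (F l \<Otimes>\<^sub>M borel)" unfolding G_def by measurable
  qed (simp add: G_def)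
  also have "\<dots> = (\<integral>u. (if u \<le> x then wait_prob n l x - (if ?d \<le> u then wait_prob n l u else 0) else 0) \<partial>unif01)"
  proof (rule Bochner_Integration.integral_cong[OF refl])
    fix u
    let ?W = "\<lambda>y. {\<omega> \<in> space M. no_stop n l \<omega> \<and> mx l \<omega> \<le> y}"
    consider "x < u" | "u \<le> x" "u < ?d" | "u \<le> x" "?d \<le> u" by linarith
    then show "expectation (\<lambda>\<omega>. G \<omega> u) = (if u \<le> x then wait_prob n l x - (if ?d \<le> u then wait_prob n l u else 0) else 0)"
    proof cases
      case 1
      then show ?thesis by (simp add: G_def)
    next
      case 2
      then have "expectation (\<lambda>\<omega>. G \<omega> u) = expectation (indicator (?W x))"
        by (intro Bochner_Integration.integral_cong) (auto simp: G_def indicator_def)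
      then show ?thesis using 2 by (simp add: wait_prob_def)
    next
      case 3
      then have "expectation (\<lambda>\<omega>. G \<omega> u) = expectation (indicator (?W x - ?W u))"
        by (intro Bochner_Integration.integral_cong) (auto simp: G_def indicator_def)
      also have "\<dots> = prob (?W x - ?W u)" by simp
      also have "\<dots> = prob (?W x) - prob (?W u)"
        using 3 by (intro finite_measure_Diff) auto
      finally show ?thesis using 3 by (simp add: wait_prob_def)
    qed
  qed
  finally show ?thesis .
qed

lemma wait_prob_0: "0 \<le> x \<Longrightarrow> wait_prob n 0 x = 1"
  by (simp add: wait_prob_def no_stop_def prob_space)

lemma integral_unif01_initial:
  assumes "0 \<le> x" "x \<le> 1"
  shows "(\<integral>u. (if u \<le> x then 1 else 0) \<partial>unif01) = x"
proof -
  have "(\<integral>u. (if u \<le> x then 1 else 0) \<partial>unif01) = (\<integral>u. indicator {0..x} u * u ^ 0 \<partial>unif01)"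
  proof (rule integral_cong_AE)
    show "AE u in unif01. (if u \<le> x then 1 else 0) = indicator {0..x} u * u ^ 0"
      using AE_unif01 by eventually_elim (auto simp: indicator_def)
  qed measurable
  then show ?thesis using assms by (simp only: integral_unif01_power) simp
qed

text \<open>The family e is general so that the start l = 0, with the single value 1, and the
  induction step are instances of one computation. The lower limit of integration, the new
  threshold, contributes the same term for every j.\<close>

lemma wait_prob_Suc_explicit:
  assumes x: "0 \<le> x" "x \<le> 1" and I: "finite I" and e: "\<And>j. j \<in> I \<Longrightarrow> decision_number (n - Suc l) \<le> e j"
    and w: "\<And>u. 0 \<le> u \<Longrightarrow> u \<le> 1 \<Longrightarrow> wait_prob n l u = a * (\<Sum>j\<in>I. min u (e j) ^ l)"
  defines "d \<equiv> min x (decision_number (n - Suc l))"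
  shows "wait_prob n (Suc l) x = a * (\<Sum>j\<in>I. (real l * min x (e j) ^ Suc l + d ^ Suc l) / real (Suc l))"
proof -
  let ?d = "decision_number (n - Suc l)"
  let ?f = "\<lambda>j u. (if ?d \<le> u \<and> u \<le> x then u ^ 0 * min u (e j) ^ l else 0)"
  have d0: "0 \<le> ?d" by (rule decision_number_nonneg)
  have "e j \<ge> 0" if "j \<in> I" for j using e[OF that] d0 by linarith
  then have intf: "integrable unif01 (?f j)" if "j \<in> I" for j
    using that by (intro integrable_unif01_bounded[where B = 1]) (auto intro!: power_le_one)
  have int1: "integrable unif01 (\<lambda>u. wait_prob n l x * (if u \<le> x then 1 else 0))"
    by (intro integrable_mult_right integrable_unif01_bounded[where B = 1]) auto
  have "wait_prob n (Suc l) x = (\<integral>u. wait_prob n l x * (if u \<le> x then 1 else 0) - a * (\<Sum>j\<in>I. ?f j u) \<partial>unif01)"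
    unfolding wait_prob_Suc
  proof (rule integral_cong_AE)
    have eq: "AE u in unif01. (if u \<le> x then wait_prob n l x - (if ?d \<le> u then wait_prob n l u else 0) else 0)
        = wait_prob n l x * (if u \<le> x then 1 else 0) - a * (\<Sum>j\<in>I. ?f j u)"
      using AE_unif01 by eventually_elim (auto simp: w)
    then show "AE u in unif01. (if u \<le> x then wait_prob n l x - (if ?d \<le> u then wait_prob n l u else 0) else 0)
        = wait_prob n l x * (if u \<le> x then 1 else 0) - a * (\<Sum>j\<in>I. ?f j u)" .
    have [measurable]: "wait_prob n l \<in> borel_measurable borel"
      by (intro borel_measurable_mono monoI) (auto simp: wait_prob_def intro!: finite_measure_mono)
    show "(\<lambda>u. if u \<le> x then wait_prob n l x - (if ?d \<le> u then wait_prob n l u else 0) else 0) \<in> borel_measurable unif01"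
      by measurable
  qed measurable
  also have "\<dots> = wait_prob n l x * x - a * (\<Sum>j\<in>I. \<integral>u. ?f j u \<partial>unif01)"
    using int1 intf x by (simp add: Bochner_Integration.integral_diff Bochner_Integration.integral_sum integral_unif01_initial
      del: power_0)
  also have "\<dots> = a * (\<Sum>j\<in>I. min x (e j) ^ l * x - (\<integral>u. ?f j u \<partial>unif01))"
    using x by (simp only: w sum_subtractf sum_distrib_right right_diff_distrib mult.assoc)
  also have "\<dots> = a * (\<Sum>j\<in>I. (real l * min x (e j) ^ Suc l + d ^ Suc l) / real (Suc l))"
  proof (intro arg_cong[where f = "\<lambda>x. a * x"] sum.cong refl)
    fix j assume j: "j \<in> I"
    show "min x (e j) ^ l * x - (\<integral>u. ?f j u \<partial>unif01) = (real l * min x (e j) ^ Suc l + d ^ Suc l) / real (Suc l)"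
    proof (cases "?d \<le> x")
      case True
      show ?thesis
        unfolding integral_unif01_min[OF d0 True x(2) e[OF j]] using True
        by (simp add: d_def min_absorb2 divide_simps) (simp add: algebra_simps)
    next
      case False
      then have "(\<integral>u. ?f j u \<partial>unif01) = 0" by (intro integral_eq_zero_AE AE_I2) auto
      moreover have "min x (e j) = x" "d = x" using False e[OF j] by (auto simp: d_def)
      ultimately show ?thesis by (simp add: divide_simps) (simp add: algebra_simps)
    qed
  qed
  finally show ?thesis .
qed

text \<open>The summand for j is the probability that l observations stay below both x and d(n - j).
  In the induction step the weight 1 / l of the old summands becomes 1 / (l + 1), and the l equal
  terms from the new threshold merge into the summand j = l + 1.\<close>

lemma wait_prob_eq:
  assumes "1 \<le> l" "l \<le> n" "0 \<le> x" "x \<le> 1"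
  shows "wait_prob n l x = 1 / real l * (\<Sum>j\<in>{1..l}. min x (decision_number (n - j)) ^ l)"
  using assms
proof (induction l arbitrary: x rule: dec_induct)
  case base
  \<comment> \<open>The auxiliary value 1 encodes \<open>wait_prob n 0\<close> = 1; its own term
    disappears through the factor l = 0.\<close>
  have "wait_prob n (Suc 0) x = 1 * (\<Sum>j\<in>{0}. (real 0 * min x 1 ^ Suc 0 + min x (decision_number (n - Suc 0)) ^ Suc 0) / real (Suc 0))"
    using base decision_number_less_1
    by (intro wait_prob_Suc_explicit) (auto simp: wait_prob_0 less_imp_le)
  then show ?case by simp
next
  case (step l)
  have "wait_prob n (Suc l) x = 1 / real l * (\<Sum>j\<in>{1..l}. (real l * min x (decision_number (n - j)) ^ Suc l
      + min x (decision_number (n - Suc l)) ^ Suc l) / real (Suc l))"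
    using step by (intro wait_prob_Suc_explicit) (auto intro!: decision_number_mono)
  also have "\<dots> = 1 / real (Suc l) * (\<Sum>j\<in>{1..Suc l}. min x (decision_number (n - j)) ^ Suc l)"
    using step(1) by (simp add: sum.distrib add_divide_distrib flip: sum_divide_distrib sum_distrib_left del: power_Suc)
  finally show ?case .
qed

end

section \<open>The exact stopping weights\<close>

context uniform_sample
begin

lemma prob_optimal_stop:
  assumes opt: "optimal_stopping_rule M X n \<tau>" and i: "1 \<le> i" "i \<le> n"
  shows "real n * prob {\<omega> \<in> space M. \<tau> \<omega> = i \<and> X i \<omega> = Max ((\<lambda>j. X j \<omega>) ` {1..n})} = stop_weight n i"
proof -
  let ?p = "prob {\<omega> \<in> space M. \<tau> \<omega> = i \<and> X i \<omega> = Max ((\<lambda>j. X j \<omega>) ` {1..n})}"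
  let ?d = "decision_number (n - i)"
  have d: "0 \<le> ?d" "?d \<le> 1" using decision_number_nonneg decision_number_less_1[of "n - i"] by auto
  have [measurable]: "wait_prob n l \<in> borel_measurable borel" for l
    by (intro borel_measurable_mono monoI) (auto simp: wait_prob_def intro!: finite_measure_mono)
  show ?thesis
  proof (cases "i = 1")
    case True
    have "?p = (\<integral>u. (if ?d \<le> u \<and> u \<le> 1 then u ^ (n - i) * min u 1 ^ 0 else 0) \<partial>unif01)"
      unfolding prob_optimal_stop_eq[OF opt i]
    proof (rule integral_cong_AE)
      show "AE u in unif01. (if ?d \<le> u then u ^ (n - i) * wait_prob n (i - 1) u else 0)
          = (if ?d \<le> u \<and> u \<le> 1 then u ^ (n - i) * min u 1 ^ 0 else 0)"
        using AE_unif01 by eventually_elim (use True in \<open>auto simp: wait_prob_0\<close>)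
    qed measurable
    also have "\<dots> = (1 - ?d ^ n) / real n"
      using True i d unfolding integral_unif01_min[OF d(1) d(2) order_refl d(2)]
      by (simp del: power_Suc)
    finally show ?thesis using True i by (simp add: stop_weight_def)
  next
    case False
    \<comment> \<open>There are l observations before time i and r after it: u^r is the probability
      that the later ones stay below u, and \<open>wait_prob n l u\<close> accounts for the earlier
      ones.\<close>
    define l r where "l = i - 1" and "r = n - i"
    have l: "1 \<le> l" "l \<le> n" "i = Suc l" "n = Suc (r + l)" "n - i + 1 = Suc r"
      using False i by (auto simp: l_def r_def)
    let ?e = "\<lambda>j. decision_number (n - j)"
    let ?f = "\<lambda>j u. (if ?d \<le> u \<and> u \<le> 1 then u ^ r * min u (?e j) ^ l else 0)"
    have int: "integrable unif01 (?f j)" for j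
    proof (rule integrable_unif01_bounded[where B = 1])
      show "\<bar>?f j u\<bar> \<le> 1" if "0 \<le> u" "u \<le> 1" for u
        using that decision_number_nonneg by (auto simp: abs_mult intro!: mult_le_one power_le_one)
    qed measurable
    have "?p = (\<integral>u. 1 / real l * (\<Sum>j\<in>{1..l}. ?f j u) \<partial>unif01)"
      unfolding prob_optimal_stop_eq[OF opt i]
    proof (rule integral_cong_AE)
      show "AE u in unif01. (if ?d \<le> u then u ^ (n - i) * wait_prob n (i - 1) u else 0)
          = 1 / real l * (\<Sum>j\<in>{1..l}. ?f j u)"
        using AE_unif01
      proof eventually_elim
        case (elim u)
        have "wait_prob n l u = 1 / real l * (\<Sum>j\<in>{1..l}. min u (?e j) ^ l)"
          using elim l by (intro wait_prob_eq) auto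
        then show ?case using elim unfolding l_def[symmetric] r_def[symmetric]
          by (simp add: sum_distrib_left mult_ac)
      qed
    qed measurable
    also have "\<dots> = 1 / real l * (\<Sum>j\<in>{1..l}. \<integral>u. ?f j u \<partial>unif01)"
      using int by (simp only: integral_mult_right_zero Bochner_Integration.integral_sum)
    also have "\<dots> = (\<Sum>j\<in>{1..l}. \<integral>u. ?f j u \<partial>unif01) / real l" by simp
    finally have p: "real n * ?p = (\<Sum>j\<in>{1..l}. real n * (\<integral>u. ?f j u \<partial>unif01)) / real l"
      by (simp add: sum_distrib_left)
    have "real n * (\<integral>u. ?f j u \<partial>unif01) = ?e j ^ n - ?d ^ n + real n / real (n - i + 1) * (?e j ^ l - ?e j ^ n)"
      if j: "j \<in> {1..l}" for j
    proof -
      have de: "?d \<le> ?e j" using j l by (intro decision_number_mono) auto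
      have e1: "min 1 (?e j) = ?e j" using decision_number_less_1[of "n - j"] by simp
      have e2: "?e j ^ l * (1 - ?e j ^ Suc r) = ?e j ^ l - ?e j ^ n"
        unfolding l(4) by (simp add: algebra_simps flip: power_add)
      \<comment> \<open>The integral splits at d(n - j): below it the integrand is u^(n - 1), above
        it u^r d(n - j)^l.\<close>
      have "(\<integral>u. ?f j u \<partial>unif01) = (?e j ^ n - ?d ^ n) / real n + (?e j ^ l - ?e j ^ n) / real (n - i + 1)"
        unfolding integral_unif01_min[OF d(1) d(2) order_refl de] e1 l(4)[symmetric] l(5) power_one e2 ..
      then show ?thesis using i by (simp only: distrib_left) simp
    qed
    then have "real n * ?p = (\<Sum>j\<in>{1..l}. ?e j ^ n - ?d ^ n + real n / real (n - i + 1) * (?e j ^ l - ?e j ^ n)) / real l"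
      unfolding p by simp
    moreover have "{1..l} = {1..<i}" using l by auto
    ultimately show ?thesis using False by (simp add: stop_weight_def l_def)
  qed
qed

end

theorem proposition2:
  fixes M :: "'a measure" and X :: "nat \<Rightarrow> 'a \<Rightarrow> real"
    and \<tau> :: "nat \<Rightarrow> 'a \<Rightarrow> nat" and c :: real
  assumes "prob_space M"
    and "prob_space.indep_vars M (\<lambda>_. borel) X {1..}"
    and "\<And>i. i \<ge> 1 \<Longrightarrow> distr M lborel (X i) = uniform_measure lborel {0..1}"
    and "\<And>n. n \<ge> 1 \<Longrightarrow> optimal_stopping_rule M X n (\<tau> n)"
    and "c > 0"
    and "integral {0..c} (\<lambda>x. (exp x - 1) / x) = 1"
  shows "(\<lambda>n. Max ((\<lambda>i. \<bar>limit_weight c (real i / real n)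
             - real n * measure M {\<omega> \<in> space M. \<tau> n \<omega> = i \<and> X i \<omega> = Max ((\<lambda>j. X j \<omega>) ` {1..n})}\<bar>)
           ` {1..n})) \<in> O(\<lambda>n. 1 / real n)"
proof -
  interpret prob_space M by (rule assms(1))
  interpret uniform_sample M X by unfold_locales (use assms in auto)
  interpret decision_limit c by unfold_locales (use assms in auto)
  show ?thesis
  \<comment> \<open>From n = 2 on the case i = 1 has t = 1 / n < 1, as its estimate
    requires.\<close>
  proof (rule bigoI[where c = error_const], rule eventually_sequentiallyI[of 2])
    fix n :: nat assume n: "2 \<le> n"
    let ?e = "\<lambda>i. \<bar>limit_weight c (real i / real n)
      - real n * prob {\<omega> \<in> space M. \<tau> n \<omega> = i \<and> X i \<omega> = Max ((\<lambda>j. X j \<omega>) ` {1..n})}\<bar>"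
    have opt: "optimal_stopping_rule M X n (\<tau> n)" using n by (intro assms(4)) auto
    have "?e i \<le> error_const / real n" if "i \<in> {1..n}" for i
      using that stop_weight_approx[OF n] prob_optimal_stop[OF opt] by simp
    moreover have "Max (?e ` {1..n}) \<in> ?e ` {1..n}" using n by (intro Max_in) auto
    ultimately have "0 \<le> Max (?e ` {1..n})" "Max (?e ` {1..n}) \<le> error_const / real n"
      by auto
    then show "norm (Max (?e ` {1..n})) \<le> error_const * norm (1 / real n)" by simp
  qed
qed

end
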